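(* Let $p$ be an odd prime, $d\ge1$ an integer such that $-1$ is a power of $p$ modulo $2d$, $t$ the smallest positive integer with $p^t\equiv-1\pmod{2d}$, $r$ an even positive integer, and $q=p^{2rt}$. Let $I\subset\{0,\dots,2d-1\}$ with $|I|=d$, $0\in I$ and $I\neq\{0,2,\dots,2d-2\}$, and let $X=PP(q,2d,I)$. If $\omega(X)=\sqrt{q}$, then there are at least two cliques of size $\sqrt{q}$ in $X$ that contain $\{0,1\}$.
   Context: $g$ is a fixed primitive root of $\mathbb{F}_q$; the $2d$-th cyclotomic classes are $C_j=g^j\langle g^{2d}\rangle$ (indices mod $2d$). For $I=\{m_1,\dots,m_d\}$, $PP(q,2d,I)$ is the Cayley graph on vertex set $\mathbb{F}_q$ with $x\sim y$ iff $x-y\in\bigcup_{j=1}^d C_{m_j}$. $\omega$ denotes the clique number. *)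

theory Defs
  imports Complex_Main "HOL-Library.Cardinality" "HOL-Library.Ramsey" "HOL-Number_Theory.Number_Theory"
begin

text \<open>
  The finite field is a type \<open>'a :: {field, finite}\<close>. Graphs are given by their set of
  edges, each edge a two-element set of vertices; the vertex set is \<open>UNIV\<close>. Cliques are
  those of \<^theory>\<open>HOL-Library.Ramsey\<close>.
\<close>

definition cyclic_span :: "'a::field \<Rightarrow> 'a set" where
  "cyclic_span a = range (\<lambda>k::int. a powi k)"

definition primitive_root :: "'a::{field, finite} \<Rightarrow> bool" where
  "primitive_root g \<longleftrightarrow> cyclic_span g = UNIV - {0}"

definition cyclotomic_class :: "'a::field \<Rightarrow> nat \<Rightarrow> nat \<Rightarrow> 'a set" where
  "cyclotomic_class g N j = (\<lambda>x. g ^ j * x) ` cyclic_span (g ^ N)"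

text \<open>
  The edge set is unordered, so \<open>S\<close> is meant to satisfy \<open>S = -S\<close> and \<open>0 \<notin> S\<close>.
  For the cyclotomic classes of order \<open>2d\<close> this holds as soon as \<open>4d\<close> divides \<open>q - 1\<close>,
  because then \<open>-1 = g ^ ((q - 1) div 2)\<close> lies in the class with index 0.
\<close>

definition cayley_edges :: "'a::ab_group_add set \<Rightarrow> 'a set set" where
  "cayley_edges S = {{x, y} | x y. x - y \<in> S}"

text \<open>
  The graph \<open>PP(q, 2d, I)\<close>, where \<open>q\<close> is the cardinality of the field and \<open>g\<close> its fixed
  primitive root.
\<close>

definition PP :: "'a::{field, finite} \<Rightarrow> nat \<Rightarrow> nat set \<Rightarrow> 'a set set" where
  "PP g d I = cayley_edges (\<Union>m\<in>I. cyclotomic_class g (2 * d) m)"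

definition clique_number :: "'a::finite set set \<Rightarrow> nat" where
  "clique_number E = Max (card ` {K. clique K E})"

end

theory Submission
  imports Defs "HOL-Computational_Algebra.Polynomial" "HOL-Library.Real_Mod"
begin

text \<open>
  Write \<open>Q = p^t\<close>, \<open>s = Q^r\<close>, so that the field has \<open>s\<^sup>2\<close> elements. Since \<open>2d\<close> divides \<open>Q + 1\<close>, the Gauss
  periods of order \<open>2d\<close> are governed by the quadratic exponential sums \<open>\<Sum>\<^sub>y \<psi>(b y^(Q+1))\<close>, whose absolute
  values follow from the size of the radical and whose signs follow from summing over the subfield
  \<open>F\<close> of order \<open>s\<close>. Hence \<open>\<Sum>\<^sub>z\<^sub>\<in>\<^sub>C\<^sub>j \<psi>(b z) = (s-1)/2d\<close>, diminished by \<open>s\<close> when \<open>b g^j \<in> C\<^sub>0\<close>.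
  For a clique \<open>K\<close> of size \<open>s\<close>, counting differences then forces the Fourier transform of \<open>K\<close> to vanish
  on \<open>C\<^sub>0\<close>, so every vertex of \<open>K\<close> has exactly \<open>(s-1)/d\<close> neighbours in \<open>K\<close> along differences in \<open>C\<^sub>0\<close>.

  If \<open>K\<close> is the only such clique through \<open>0\<close> and \<open>1\<close>, then \<open>(K - y)/(x - y) = K\<close> whenever \<open>x, y \<in> K\<close> and
  \<open>x - y \<in> C\<^sub>0\<close>. So \<open>H = K \<inter> C\<^sub>0\<close> is a group of order \<open>(s-1)/d\<close>, contained in \<open>F\<close>, and \<open>h - 1\<close> translates
  \<open>K\<close> to itself for \<open>h \<in> H\<close>. The ring stabilizing the group of translations of \<open>K\<close> contains \<open>H\<close>, which is too
  large for a proper subfield of \<open>F\<close>; therefore \<open>F \<subseteq> K\<close>. As \<open>F\<close> meets every class of even index, \<open>I\<close> consists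
  of the even indices.
\<close>

section \<open>Additive characters of finite fields\<close>

lemma CHAR_eq_of_card_prime_power:
  assumes "prime p" "CARD('a::{field,finite}) = p ^ n"
  shows "CHAR('a) = p"
proof -
  have "CHAR('a) > 0"
    by (rule finite_imp_CHAR_pos) simp
  hence "prime CHAR('a)"
    by (rule prime_CHAR_semidom)
  moreover have "CHAR('a) dvd p ^ n"
    using CHAR_dvd_CARD[where 'a='a] assms(2) by simp
  ultimately show ?thesis
    using assms(1) by (metis prime_dvd_power_nat primes_dvd_imp_eq)
qed

text \<open>The polynomial \<open>X^p - X\<close> has at most \<open>p\<close> roots, and the images
  of the naturals below \<open>p\<close> are already \<open>p\<close> distinct ones.\<close>

lemma frobenius_fixed_imp_of_nat:
  fixes x :: "'a::{field,finite}"
  assumes "prime p" "CHAR('a) = p" "x ^ p = x"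
  shows "\<exists>k<p. of_nat k = x"
proof -
  define P :: "'a poly" where "P = monom 1 p - monom 1 1"
  have p: "p > 1" using assms(1) by (rule prime_gt_1_nat)
  have "coeff P p = 1" using p by (simp add: P_def)
  hence "P \<noteq> 0" by auto
  moreover have "degree P \<le> p"
    unfolding P_def using p by (intro degree_diff_le) (auto simp: degree_monom_eq)
  ultimately have "card {y. poly P y = 0} \<le> p"
    using card_poly_roots_bound le_trans by blast
  moreover have "{y. poly P y = 0} = {y. y ^ p = y}"
    by (simp add: P_def poly_monom)
  ultimately have le: "card {y::'a. y ^ p = y} \<le> p" by simp
  have "(of_nat k :: 'a) ^ p = of_nat k" for k
  proof (induction k)
    case (Suc k)
    have "(1 + of_nat k :: 'a) ^ p = 1 ^ p + of_nat k ^ p"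
      by (rule freshmans_dream) (use assms in auto)
    thus ?case using Suc by simp
  qed (use p in simp)
  hence sub: "of_nat ` {..<p} \<subseteq> {y::'a. y ^ p = y}" by auto
  have "inj_on (of_nat :: nat \<Rightarrow> 'a) {..<p}"
    by (auto simp: inj_on_def of_nat_eq_iff_cong_CHAR assms cong_def)
  hence "card (of_nat ` {..<p} :: 'a set) = p" by (simp add: card_image)
  with sub le have "of_nat ` {..<p} = {y::'a. y ^ p = y}"
    by (intro card_seteq) auto
  thus ?thesis using assms(3) by (metis (mono_tags, lifting) imageE lessThan_iff mem_Collect_eq)
qed

text \<open>Multiplication by \<open>h\<close> permutes \<open>A\<close>, so the product over
  \<open>A\<close> absorbs a factor \<open>h ^ card A\<close>. It serves for Fermat's theorem here
  and later for the multiplicatively closed set \<open>H\<close>.\<close>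

lemma power_card_eq_1:
  fixes h :: "'a::field"
  assumes "finite A" "0 \<notin> A" "h \<noteq> 0" "\<And>x. x \<in> A \<Longrightarrow> h * x \<in> A"
  shows "h ^ card A = 1"
proof -
  have inj: "inj_on ((*) h) A" using assms(3) by (auto simp: inj_on_def)
  have "(*) h ` A = A" using assms(1,4) by (intro endo_inj_surj inj) auto
  hence "\<Prod>A = (\<Prod>x\<in>A. h * x)" using prod.reindex[OF inj, of "\<lambda>x. x"] by simp
  also have "\<dots> = h ^ card A * \<Prod>A" by (simp add: prod.distrib)
  finally show ?thesis using assms(1,2) by simp
qed

lemma power_CARD_minus_1:
  fixes x :: "'a::{field,finite}"
  assumes "x \<noteq> 0"
  shows "x ^ (CARD('a) - 1) = 1"
  using power_card_eq_1[of "UNIV - {0}" x] assms by (simp add: card_Diff_subset)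

lemma power_CARD_eq_self:
  fixes x :: "'a::{field,finite}"
  shows "x ^ CARD('a) = x"
proof (cases "x = 0")
  case False
  have "x ^ CARD('a) = x * x ^ (CARD('a) - 1)"
    by (metis Suc_pred' finite_UNIV_card_ge_0 finite power_Suc)
  thus ?thesis using power_CARD_minus_1[OF False] by simp
qed (simp add: power_0_left)

text \<open>The character is \<open>exp(2 pi i Tr(x)/p)\<close> with the absolute trace
  \<open>Tr\<close>. Its invariance under Frobenius is what later linearizes the exponential
  sums.\<close>

lemma additive_character_exists:
  assumes p: "prime p" and card: "CARD('a) = p ^ n"
  obtains \<psi> :: "'a::{field,finite} \<Rightarrow> complex" where
    "\<And>x y. \<psi> (x + y) = \<psi> x * \<psi> y" "\<And>x. norm (\<psi> x) = 1"
    "\<And>x. \<psi> (x ^ p) = \<psi> x" "\<exists>x. \<psi> x \<noteq> 1"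
proof -
  have char: "CHAR('a) = p" using CHAR_eq_of_card_prime_power[OF p card] .
  have p1: "p > 1" using p by (rule prime_gt_1_nat)
  have "1 < CARD('a)"
    using card_mono[of UNIV "{0, 1 :: 'a}"] by simp
  hence n0: "n > 0" using card by (cases n) auto
  define tr :: "'a \<Rightarrow> 'a" where "tr x = (\<Sum>i<n. x ^ (p ^ i))" for x
  have tr_add: "tr (x + y) = tr x + tr y" for x y
    unfolding tr_def sum.distrib[symmetric]
    by (intro sum.cong refl freshmans_dream') (use p char in auto)
  have tr_frob: "tr (x ^ p) = tr x" for x
  proof -
    have "tr (x ^ p) = (\<Sum>i<n. x ^ (p ^ Suc i))"
      unfolding tr_def by (intro sum.cong) (auto simp: power_mult[symmetric])
    moreover have "(\<Sum>i<n. x ^ (p ^ Suc i)) + x ^ p ^ 0 = (\<Sum>i<Suc n. x ^ (p ^ i))"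
      unfolding sum.lessThan_Suc_shift by simp
    moreover have "x ^ p ^ n = x" using power_CARD_eq_self[of x] card by simp
    ultimately show ?thesis by (simp add: tr_def)
  qed
  have tr_pow: "tr x ^ p = tr x" for x
  proof -
    have "tr x ^ p = (\<Sum>i<n. (x ^ (p ^ i)) ^ p)"
      unfolding tr_def by (rule freshmans_dream_sum) (use p char in auto)
    also have "\<dots> = tr (x ^ p)"
      unfolding tr_def by (intro sum.cong) (auto simp: power_mult[symmetric] mult.commute)
    finally show ?thesis by (simp add: tr_frob)
  qed
  have "\<exists>k<p. of_nat k = tr x" for x
    by (rule frobenius_fixed_imp_of_nat) (use p char tr_pow in auto)
  \<comment> \<open>\<open>k x\<close> is the residue below \<open>p\<close> that represents the
    trace in the prime field; additivity of the trace becomes a congruence modulo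
    \<open>p\<close>.\<close>
  then obtain k where k: "\<And>x. k x < p" "\<And>x. of_nat (k x) = tr x" by metis
  define \<psi> where "\<psi> x = cis (2 * pi * (real (k x) / real p))" for x
  have add: "\<psi> (x + y) = \<psi> x * \<psi> y" for x y
  proof -
    have "(of_nat (k x + k y) :: 'a) = of_nat (k (x + y))" by (simp add: k tr_add)
    hence "[k x + k y = k (x + y)] (mod p)"
      using char of_nat_eq_iff_cong_CHAR by blast
    hence "[int (k x + k y) = int (k (x + y))] (mod int p)"
      by (simp only: cong_int_iff)
    then obtain l where "int (k x + k y) = int (k (x + y)) + int p * l"
      by (metis cong_iff_lin cong_sym)
    hence "real (k x + k y) = real (k (x + y)) + real p * of_int l"
      by (metis of_int_add of_int_mult of_int_of_nat_eq)
    hence "real (k x) / p + real (k y) / p = real (k (x + y)) / p + of_int l"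
      using p1 by (simp add: field_simps)
    hence "\<psi> x * \<psi> y = cis (2 * pi * (real (k (x + y)) / p + of_int l))"
      unfolding \<psi>_def cis_mult by (metis distrib_left)
    also have "\<dots> = \<psi> (x + y)"
      unfolding \<psi>_def by (simp add: distrib_left cis_mult[symmetric])
    finally show ?thesis by simp
  qed
  have "\<exists>x. tr x \<noteq> 0"
  proof (rule ccontr)
    assume "\<not> (\<exists>x. tr x \<noteq> 0)"
    \<comment> \<open>If the trace vanished identically, this nonzero polynomial of degree at most
      \<open>p ^ (n - 1)\<close> would have \<open>p ^ n\<close> roots.\<close>
    define P :: "'a poly" where "P = (\<Sum>i<n. monom 1 (p ^ i))"
    have "coeff P 1 = (\<Sum>i<n. if i = 0 then 1 else 0)"
      unfolding P_def coeff_sum using p1 by (intro sum.cong) auto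
    also have "\<dots> = 1" using n0 by (subst sum.delta) auto
    finally have "P \<noteq> 0" by auto
    moreover have "degree P \<le> p ^ (n - 1)"
      unfolding P_def using p1 n0
      by (intro degree_sum_le) (auto simp: degree_monom_eq intro!: power_increasing)
    ultimately have "card {y. poly P y = 0} \<le> p ^ (n - 1)"
      using card_poly_roots_bound le_trans by blast
    moreover have "{y. poly P y = 0} = UNIV"
      using \<open>\<not> (\<exists>x. tr x \<noteq> 0)\<close> by (simp add: P_def poly_sum poly_monom tr_def)
    moreover have "p ^ (n - 1) < p ^ n"
      using p1 n0 by (intro power_strict_increasing) auto
    ultimately show False using card by simp
  qed
  then obtain x where "tr x \<noteq> 0" by blast
  hence kx: "0 < k x" using k(2)[of x] by (cases "k x") auto
  have "\<psi> x \<noteq> 1"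
  proof
    assume "\<psi> x = 1"
    then obtain m :: int where "2 * pi * (real (k x) / real p) = of_int m * (2 * pi)"
      unfolding \<psi>_def cis_eq_1_iff by blast
    hence "2 * pi * real (k x) = 2 * pi * (real_of_int m * real p)" using p1 by (simp add: field_simps)
    hence "real (k x) = of_int (m * int p)" by simp
    hence "int (k x) = m * int p" by linarith
    hence "p dvd k x" by (metis dvd_triv_right int_dvd_int_iff)
    thus False using kx k(1)[of x] by (auto dest: dvd_imp_le)
  qed
  moreover have "\<psi> (x ^ p) = \<psi> x" for x
  proof -
    have "(of_nat (k (x ^ p)) :: 'a) = of_nat (k x)" by (simp add: k tr_frob)
    hence "[k (x ^ p) = k x] (mod p)" using char of_nat_eq_iff_cong_CHAR by blast
    thus ?thesis using k(1) by (simp add: \<psi>_def cong_def)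
  qed
  moreover have "norm (\<psi> x) = 1" for x by (simp add: \<psi>_def)
  ultimately show ?thesis using that[of \<psi>] add by blast
qed

section \<open>Roots of unity and cyclotomic classes\<close>

lemma CARD_field_gt_1: "CARD('a::{field,finite}) > 1"
  using card_mono[of UNIV "{0, 1 :: 'a}"] by simp

context
  fixes g :: "'a::{field,finite}"
  assumes prim: "primitive_root g"
begin

lemma primitive_root_nonzero: "g \<noteq> 0"
proof -
  have "g powi 1 \<in> cyclic_span g" unfolding cyclic_span_def by blast
  thus ?thesis using prim by (auto simp: primitive_root_def)
qed

text \<open>Exponents matter only modulo \<open>CARD('a) - 1\<close>, so negative powers bring
  nothing new and \<open>cyclic_span\<close> consists of natural powers.\<close>

lemma powi_eq_power:
  fixes k :: int and x :: 'a
  assumes "x \<noteq> 0"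
  shows "\<exists>n. x powi k = x ^ n"
proof -
  let ?m = "CARD('a) - 1"
  have pos: "?m > 0" using CARD_field_gt_1[where 'a='a] by simp
  have "x powi k = x powi (int ?m * (k div int ?m) + k mod int ?m)" by simp
  also have "\<dots> = (x ^ ?m) powi (k div int ?m) * x powi (k mod int ?m)"
    using assms by (simp only: power_int_add power_int_mult power_int_of_nat simp_thms)
  also have "\<dots> = x powi int (nat (k mod int ?m))"
    using assms pos by (simp add: power_CARD_minus_1 del: of_nat_diff One_nat_def)
  finally show ?thesis unfolding power_int_of_nat by blast
qed

lemma primitive_root_generates:
  assumes "x \<noteq> 0"
  shows "\<exists>k. x = g ^ k"
proof -
  have "x \<in> cyclic_span g" using prim assms by (simp add: primitive_root_def)
  then obtain k :: int where "x = g powi k" unfolding cyclic_span_def by blast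
  thus ?thesis using powi_eq_power[OF primitive_root_nonzero] by auto
qed

lemma primitive_root_power_eq_1_iff: "g ^ k = 1 \<longleftrightarrow> CARD('a) - 1 dvd k"
proof
  let ?n = "CARD('a) - 1"
  assume k: "g ^ k = 1"
  define m where "m = k mod ?n"
  have "g ^ k = g ^ (?n * (k div ?n) + m)" by (simp add: m_def)
  also have "\<dots> = g ^ m" by (simp add: power_add power_mult power_CARD_minus_1 primitive_root_nonzero del: One_nat_def)
  finally have gm: "g ^ m = 1" using k by simp
  have "m = 0"
  proof (rule ccontr)
    assume "m \<noteq> 0"
    \<comment> \<open>A smaller period \<open>m\<close> would leave room for only \<open>m\<close>
      distinct powers, too few for all nonzero elements.\<close>
    have "UNIV - {0} \<subseteq> (\<lambda>j. g ^ j) ` {..<m}"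
    proof
      fix x :: 'a assume "x \<in> UNIV - {0}"
      then obtain k where "x = g ^ k" using primitive_root_generates by auto
      also have "\<dots> = g ^ (m * (k div m) + k mod m)" by simp
      also have "\<dots> = g ^ (k mod m)" unfolding power_add power_mult gm by simp
      finally show "x \<in> (\<lambda>j. g ^ j) ` {..<m}" using \<open>m \<noteq> 0\<close> by auto
    qed
    hence "card (UNIV - {0::'a}) \<le> card ((\<lambda>j. g ^ j) ` {..<m})" by (intro card_mono) auto
    also have "\<dots> \<le> m" using card_image_le[of "{..<m}" "\<lambda>j. g ^ j"] by simp
    finally have "?n \<le> m" by (simp add: card_Diff_subset)
    moreover have "m < ?n" unfolding m_def using CARD_field_gt_1[where 'a='a] by simp
    ultimately show False by simp
  qed
  thus "?n dvd k" unfolding m_def by (rule mod_0_imp_dvd)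
next
  assume "CARD('a) - 1 dvd k"
  thus "g ^ k = 1" by (auto simp: power_mult power_CARD_minus_1 primitive_root_nonzero simp del: One_nat_def)
qed

lemma primitive_root_power_eq_iff: "g ^ a = g ^ b \<longleftrightarrow> [a = b] (mod (CARD('a) - 1))"
proof (induction a b rule: linorder_wlog)
  case (le a b)
  have "g ^ b = g ^ a * g ^ (b - a)" using le by (simp flip: power_add)
  hence "g ^ a = g ^ b \<longleftrightarrow> g ^ (b - a) = 1" using primitive_root_nonzero by auto
  also have "\<dots> \<longleftrightarrow> [b = a] (mod (CARD('a) - 1))"
    unfolding primitive_root_power_eq_1_iff using le by (simp add: cong_altdef_nat)
  finally show ?case by (simp add: cong_sym_eq)
qed (metis cong_sym)

context
  fixes m n :: nat
  assumes mn: "m * n = CARD('a) - 1"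
begin

lemma cofactors_pos: "m > 0" "n > 0"
proof -
  have "m * n > 0" using mn CARD_field_gt_1[where 'a='a] by simp
  thus "m > 0" "n > 0" by auto
qed

lemma root_of_unity_iff_power: "(x::'a) ^ m = 1 \<longleftrightarrow> (\<exists>k. x = (g ^ n) ^ k)"
proof
  assume "x ^ m = 1"
  moreover from this have "x \<noteq> 0" using cofactors_pos by (metis power_0_left zero_neq_one not_gr_zero)
  then obtain j where j: "x = g ^ j" using primitive_root_generates by blast
  ultimately have "m * n dvd j * m"
    unfolding mn by (simp add: power_mult[symmetric] primitive_root_power_eq_1_iff)
  hence "n dvd j" using cofactors_pos by (simp add: mult.commute)
  thus "\<exists>k. x = (g ^ n) ^ k" using j by (auto simp: dvd_def power_mult)
next
  assume "\<exists>k. x = (g ^ n) ^ k"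
  then obtain k where "x = g ^ (n * k)" by (auto simp: power_mult)
  hence "x ^ m = (g ^ (m * n)) ^ k" by (simp add: power_mult[symmetric] mult_ac)
  thus "x ^ m = 1" by (simp add: mn power_CARD_minus_1 primitive_root_nonzero del: One_nat_def)
qed

text \<open>In a cyclic group of order \<open>m * n\<close> the elements killed by \<open>m\<close>
  are exactly the \<open>n\<close>-th powers. This exchanges an equation for a witness and
  back.\<close>

lemma root_of_unity_iff_nth_power: "(x::'a) ^ m = 1 \<longleftrightarrow> (\<exists>y. y \<noteq> 0 \<and> x = y ^ n)"
proof
  assume "x ^ m = 1"
  then obtain k where "x = (g ^ n) ^ k" using root_of_unity_iff_power by blast
  hence "x = (g ^ k) ^ n" by (simp add: power_mult[symmetric] mult.commute)
  thus "\<exists>y. y \<noteq> 0 \<and> x = y ^ n" using primitive_root_nonzero by (intro exI[of _ "g ^ k"]) auto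
next
  assume "\<exists>y. y \<noteq> 0 \<and> x = y ^ n"
  then obtain y where "y \<noteq> 0" "x = y ^ n" by blast
  thus "x ^ m = 1" by (simp add: power_mult[symmetric] mult.commute mn power_CARD_minus_1 del: One_nat_def)
qed

lemma card_roots_of_unity: "card {x::'a. x ^ m = 1} = m"
proof -
  have "{x::'a. x ^ m = 1} = (\<lambda>i. g ^ (n * i)) ` {..<m}"
  proof (intro equalityI subsetI)
    fix x :: 'a assume "x \<in> {x::'a. x ^ m = 1}"
    hence "x ^ m = 1" by simp
    then obtain k where "x = (g ^ n) ^ k" unfolding root_of_unity_iff_power by blast
    hence k: "x = g ^ (n * k)" by (simp add: power_mult)
    have "[n * k = n * (k mod m)] (mod (n * m))"
      by (simp add: cong_def)
    hence "x = g ^ (n * (k mod m))"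
      unfolding k primitive_root_power_eq_iff mn[symmetric] by (simp add: mult.commute)
    thus "x \<in> (\<lambda>i. g ^ (n * i)) ` {..<m}" using cofactors_pos by auto
  next
    fix x :: 'a assume "x \<in> (\<lambda>i. g ^ (n * i)) ` {..<m}"
    then obtain k where "x = (g ^ n) ^ k" by (auto simp: power_mult)
    hence "x ^ m = 1" unfolding root_of_unity_iff_power by blast
    thus "x \<in> {x::'a. x ^ m = 1}" by simp
  qed
  moreover have "inj_on (\<lambda>i. g ^ (n * i)) {..<m}"
  proof (rule inj_onI)
    fix i j assume ij: "i \<in> {..<m}" "j \<in> {..<m}" "g ^ (n * i) = g ^ (n * j)"
    hence "[n * i = n * j] (mod (n * m))"
      by (simp add: primitive_root_power_eq_iff mn[symmetric] mult.commute del: One_nat_def)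
    moreover have "n * i < n * m" "n * j < n * m" using ij cofactors_pos by auto
    ultimately show "i = j" using cofactors_pos by (simp add: cong_def)
  qed
  ultimately show ?thesis by (simp add: card_image)
qed

lemma cyclic_span_eq_roots_of_unity: "cyclic_span (g ^ n) = {x::'a. x ^ m = 1}"
proof (intro equalityI subsetI)
  fix x :: 'a assume "x \<in> cyclic_span (g ^ n)"
  then obtain k :: int where "x = (g ^ n) powi k" unfolding cyclic_span_def by blast
  then obtain j where "x = (g ^ n) ^ j"
    using powi_eq_power[of "g ^ n" k] primitive_root_nonzero by auto
  hence "x ^ m = 1" unfolding root_of_unity_iff_power by blast
  thus "x \<in> {x. x ^ m = 1}" by simp
next
  fix x :: 'a assume "x \<in> {x. x ^ m = 1}"
  hence "x ^ m = 1" by simp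
  then obtain k where "x = (g ^ n) powi int k" unfolding root_of_unity_iff_power by auto
  thus "x \<in> cyclic_span (g ^ n)" unfolding cyclic_span_def by blast
qed

lemma cyclotomic_class_conv:
  "cyclotomic_class g n j = (\<lambda>x. g ^ j * x) ` {x. x ^ m = 1}"
  by (simp add: cyclotomic_class_def cyclic_span_eq_roots_of_unity)

lemma mem_cyclotomic_class_iff:
  "x \<in> cyclotomic_class g n j \<longleftrightarrow> (x / g ^ j) ^ m = 1"
proof -
  have "x = g ^ j * (x / g ^ j)" using primitive_root_nonzero by simp
  thus ?thesis unfolding cyclotomic_class_conv using primitive_root_nonzero by (auto simp: image_iff)
qed

lemma primitive_root_power_mem_cyclotomic_class_iff:
  "g ^ i \<in> cyclotomic_class g n j \<longleftrightarrow> [i = j] (mod n)"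
proof -
  have "g ^ i \<in> cyclotomic_class g n j \<longleftrightarrow> g ^ (i * m) = g ^ (j * m)"
    unfolding mem_cyclotomic_class_iff using primitive_root_nonzero
    by (simp add: power_divide power_mult)
  also have "\<dots> \<longleftrightarrow> [i * m = j * m] (mod (n * m))"
    by (simp add: primitive_root_power_eq_iff mn[symmetric] mult.commute del: One_nat_def)
  also have "\<dots> \<longleftrightarrow> [i = j] (mod n)"
    using cofactors_pos by (simp add: cong_def mod_mult_mult2)
  finally show ?thesis .
qed

end

end

section \<open>Exponential sums in the semiprimitive case\<close>

lemma sum_rotate:
  "(\<Sum>a\<in>A. \<Sum>b\<in>B. \<Sum>c\<in>C. f a b c) = (\<Sum>b\<in>B. \<Sum>c\<in>C. \<Sum>a\<in>A. f a b c)"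
  for f :: "'a \<Rightarrow> 'b \<Rightarrow> 'c \<Rightarrow> 'd::comm_monoid_add"
  by (subst sum.swap) (rule sum.cong[OF refl sum.swap])

locale additive_character =
  fixes \<psi> :: "'a::{field,finite} \<Rightarrow> complex"
  assumes psi_add: "\<psi> (x + y) = \<psi> x * \<psi> y"
    and norm_psi [simp]: "norm (\<psi> x) = 1"
    and psi_nontrivial: "\<exists>x. \<psi> x \<noteq> 1"
begin

lemma psi_nonzero [simp]: "\<psi> x \<noteq> 0"
  using norm_psi[of x] by fastforce

lemma psi_0 [simp]: "\<psi> 0 = 1"
  using psi_add[of 0 0] by simp

lemma cnj_psi: "cnj (\<psi> x) = \<psi> (- x)"
proof -
  have "\<psi> x * \<psi> (- x) = 1" using psi_add[of x "- x"] by simp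
  moreover have "\<psi> x * cnj (\<psi> x) = 1"
    using complex_norm_square[of "\<psi> x"] by simp
  ultimately show ?thesis by (metis mult_left_cancel psi_nonzero)
qed

lemma psi_of_nat_mult: "\<psi> (of_nat n * x) = \<psi> x ^ n"
  by (induction n) (auto simp: psi_add distrib_right)

text \<open>For \<open>b \<noteq> 0\<close>, shifting \<open>x\<close> by \<open>z / b\<close> with
  \<open>\<psi> z \<noteq> 1\<close> multiplies the sum by \<open>\<psi> z\<close> and leaves it
  unchanged.\<close>

lemma sum_psi: "(\<Sum>x\<in>UNIV. \<psi> (b * x)) = (if b = 0 then of_nat CARD('a) else 0)"
proof (cases "b = 0")
  case False
  obtain z where z: "\<psi> z \<noteq> 1" using psi_nontrivial by blast
  have "\<psi> z * (\<Sum>x\<in>UNIV. \<psi> (b * x)) = (\<Sum>x\<in>UNIV. \<psi> (b * (x + z / b)))"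
    using False by (simp add: sum_distrib_left distrib_left psi_add mult.commute)
  also have "\<dots> = (\<Sum>x\<in>UNIV. \<psi> (b * x))"
    by (rule sum.reindex_bij_witness[of _ "\<lambda>x. x - z / b" "\<lambda>x. x + z / b"]) auto
  finally show ?thesis using z False by simp
qed simp

lemma sum_psi': "(\<Sum>x\<in>UNIV. \<psi> (x * b)) = (if b = 0 then of_nat CARD('a) else 0)"
  using sum_psi[of b] by (simp add: mult.commute)

end

locale semiprimitive_field = additive_character \<psi>
  for \<psi> :: "'a::{field,finite} \<Rightarrow> complex" +
  fixes p t r d :: nat and g :: 'a
  assumes p: "prime p" "odd p"
    and d_pos: "d > 0" and t_pos: "t > 0"
    and dvd_Q: "2 * d dvd p ^ t + 1"
    and r: "even r" "r > 0"
    and card_eq: "CARD('a) = p ^ (2 * r * t)"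
    and prim: "primitive_root g"
    and psi_p: "\<psi> (x ^ p) = \<psi> x"
begin

definition Q where "Q = p ^ t"
definition s where "s = Q ^ r"

lemma char: "CHAR('a) = p"
  using CHAR_eq_of_card_prime_power p(1) card_eq .

lemma CARD_eq: "CARD('a) = s * s"
proof -
  have "2 * r * t = t * r + t * r" by simp
  thus ?thesis unfolding card_eq s_def Q_def by (simp only: power_add power_mult)
qed

lemma Q_ge: "Q \<ge> 3" "Q + 1 \<ge> 2 * d"
proof -
  have "p \<noteq> 2" using p(2) by auto
  hence "p \<ge> 3" using p(1) prime_ge_2_nat[of p] by simp
  moreover have "p ^ 1 \<le> p ^ t" using t_pos p(1) prime_gt_0_nat[of p] by (intro power_increasing) auto
  ultimately show "Q \<ge> 3" by (simp add: Q_def)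
  show "Q + 1 \<ge> 2 * d" using dvd_Q unfolding Q_def by (rule dvd_imp_le) simp
qed

lemma Q2_le_s: "Q * Q \<le> s"
proof -
  have "2 \<le> r" using r by presburger
  hence "Q ^ 2 \<le> Q ^ r" using Q_ge by (intro power_increasing) auto
  thus ?thesis by (simp add: s_def power2_eq_square)
qed

lemma s_ge: "s \<ge> 9"
proof -
  have "3 * 3 \<le> Q * Q" using Q_ge by (intro mult_mono) auto
  thus ?thesis using Q2_le_s by simp
qed

lemma odd_s: "odd s"
  using p by (simp add: s_def Q_def)

text \<open>Since \<open>r\<close> is even, \<open>s\<close> is a power of \<open>Q^2\<close>, hence
  congruent to 1 modulo \<open>Q^2 - 1\<close>.\<close>

lemma s_minus_1: obtains u where "s - 1 = (Q - 1) * (Q + 1) * u"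
proof -
  obtain k where k: "r = 2 * k" using r by blast
  have eq: "(Q - 1) * (Q + 1) = Q ^ 2 - 1" using Q_ge by (cases Q) (auto simp: power2_eq_square)
  have "[Q ^ 2 = 1] (mod (Q ^ 2 - 1))"
    using Q_ge by (simp add: cong_altdef_nat)
  hence "[(Q ^ 2) ^ k = 1 ^ k] (mod (Q ^ 2 - 1))" by (rule cong_pow)
  moreover have "s = (Q ^ 2) ^ k" unfolding s_def by (simp add: k power_mult)
  ultimately have "[s = 1] (mod (Q ^ 2 - 1))" by simp
  hence "(Q - 1) * (Q + 1) dvd s - 1" using s_ge unfolding eq by (simp add: cong_altdef_nat)
  thus ?thesis using that by blast
qed

lemma CARD_minus_1: "(s - 1) * (s + 1) = CARD('a) - 1"
  using s_ge unfolding CARD_eq by (cases s) auto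

lemma Q2_minus_1_cofactor:
  obtains u where "(2 * u) * ((Q - 1) * (Q + 1)) = CARD('a) - 1"
proof -
  obtain u where u: "s - 1 = (Q - 1) * (Q + 1) * u" using s_minus_1 .
  obtain v where v: "s + 1 = 2 * v" using odd_s by (metis dvdE odd_even_add odd_one)
  have "CARD('a) - 1 = ((Q - 1) * (Q + 1) * u) * (2 * v)"
    unfolding CARD_minus_1[symmetric] u v ..
  also have "\<dots> = (2 * (u * v)) * ((Q - 1) * (Q + 1))" by (simp only: mult_ac)
  finally show ?thesis using that by metis
qed

lemma psi_frob: "\<psi> (x ^ Q) = \<psi> x"
proof -
  have "\<psi> (x ^ p ^ n) = \<psi> x" for n
    by (induction n) (simp_all add: power_mult mult.commute[of p] psi_p)
  thus ?thesis by (simp add: Q_def)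
qed

lemma frob_add: "((x::'a) + y) ^ Q = x ^ Q + y ^ Q" "((x::'a) + y) ^ s = x ^ s + y ^ s"
proof -
  show "(x + y) ^ Q = x ^ Q + y ^ Q"
    by (rule freshmans_dream'[of _ t]) (use p char in \<open>auto simp: Q_def\<close>)
  show "(x + y) ^ s = x ^ s + y ^ s"
    by (rule freshmans_dream'[of _ "t * r"]) (use p char in \<open>auto simp: Q_def s_def power_mult\<close>)
qed

lemma two_neq_0: "(2::'a) \<noteq> 0"
proof
  assume "(2::'a) = 0"
  hence "of_nat 2 = (0::'a)" by simp
  hence "p dvd 2" unfolding of_nat_eq_0_iff_char_dvd char .
  hence "p \<le> 2" by (rule dvd_imp_le) simp
  hence "p = 2" using p prime_ge_2_nat[of p] by linarith
  thus False using p by simp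
qed

text \<open>The cofactor of \<open>Q^2 - 1\<close> in the order of the multiplicative group is even,
  so it kills \<open>- 1\<close>.\<close>

lemma minus_one_power: "\<exists>v::'a. v \<noteq> 0 \<and> v ^ ((Q - 1) * (Q + 1)) = - 1"
proof -
  obtain u where u: "(2 * u) * ((Q - 1) * (Q + 1)) = CARD('a) - 1" using Q2_minus_1_cofactor .
  have "(- 1 :: 'a) ^ (2 * u) = 1" by simp
  thus ?thesis using root_of_unity_iff_nth_power[OF prim u] by metis
qed

section \<open>Exponential sums over the powers \<open>y ^ (Q + 1)\<close>\<close>

definition W :: "'a \<Rightarrow> complex" where "W b = (\<Sum>y\<in>UNIV. \<psi> (b * y ^ (Q + 1)))"

lemma W_mult:
  assumes "c \<noteq> 0"
  shows "W (b * c ^ (Q + 1)) = W b"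
  unfolding W_def
  by (rule sum.reindex_bij_witness[of _ "\<lambda>y. y / c" "\<lambda>y. c * y"])
    (use assms in \<open>auto simp: power_mult_distrib mult_ac\<close>)

lemma W_0: "W 0 = of_nat CARD('a)"
  by (simp add: W_def)

text \<open>Conjugation replaces \<open>b\<close> by \<open>- b\<close>, and \<open>- 1\<close> is a
  \<open>(Q + 1)\<close>-th power, which \<open>W\<close> does not see.\<close>

lemma cnj_W: "cnj (W b) = W b"
proof -
  obtain v :: 'a where v: "v \<noteq> 0" "v ^ ((Q - 1) * (Q + 1)) = - 1" using minus_one_power by blast
  have "cnj (W b) = W (- b)" by (simp add: W_def cnj_psi)
  also have "- b = b * (v ^ (Q - 1)) ^ (Q + 1)"
    using v(2) unfolding power_mult by (simp del: One_nat_def power_Suc)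
  also have "W \<dots> = W b" using v by (intro W_mult) auto
  finally show ?thesis .
qed

definition w :: "'a \<Rightarrow> real" where "w b = Re (W b)"

lemma W_eq_w: "W b = of_real (w b)"
  using cnj_W[of b] by (simp add: w_def complex_eq_iff)

text \<open>The argument \<open>c\<close> satisfies \<open>c ^ Q = - c\<close>, so Frobenius
  invariance gives \<open>\<psi> c = \<psi> (- c)\<close> and \<open>\<psi> c\<close> is 1 or -1. It
  is also a \<open>p\<close>-th root of unity with \<open>p\<close> odd.\<close>

lemma psi_eq_1_of_radical:
  assumes "b ^ Q * y ^ (Q * Q) + b * y = 0"
  shows "\<psi> (b * y ^ (Q + 1)) = 1"
proof -
  let ?c = "b * y ^ (Q + 1)"
  have "?c = - (?c ^ Q)"
  proof -
    have "?c = (b * y) * y ^ Q" by (simp add: mult_ac)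
    also have "b * y = - (b ^ Q * y ^ (Q * Q))" using assms by (simp add: eq_neg_iff_add_eq_0 add.commute)
    also have "\<dots> * y ^ Q = - (?c ^ Q)" by (simp add: power_mult_distrib power_mult[symmetric] power_add algebra_simps)
    finally show ?thesis .
  qed
  hence "\<psi> ?c = \<psi> (- (?c ^ Q))" by metis
  also have "\<dots> = cnj (\<psi> ?c)" by (simp add: cnj_psi[symmetric] psi_frob)
  finally have "\<psi> ?c * \<psi> ?c = 1" by (metis complex_norm_square mult.commute norm_psi of_real_1 power_one)
  hence sq: "\<psi> ?c ^ 2 = 1" by (simp add: power2_eq_square)
  have "of_nat p * ?c = 0" using char by (metis mult_zero_left of_nat_CHAR)
  hence "1 = \<psi> ?c ^ p" by (metis psi_0 psi_of_nat_mult)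
  also obtain k where "p = 2 * k + 1" using p(2) by (rule oddE)
  hence "\<psi> ?c ^ p = \<psi> ?c" using sq by (simp add: power_mult)
  finally show ?thesis by simp
qed

text \<open>Expand \<open>W b * cnj (W b)\<close> with the substitution \<open>u = z + y\<close>.
  The sum over \<open>z\<close> is then a linear character sum, which retains only the
  \<open>y\<close> in the radical of the form \<open>b y^(Q+1)\<close>.\<close>

lemma w_square: "w b ^ 2 = real CARD('a) * real (card {y. b ^ Q * y ^ (Q * Q) + b * y = 0})"
proof -
  let ?R = "{y. b ^ Q * y ^ (Q * Q) + b * y = 0}"
  have bij: "(\<Sum>z\<in>UNIV. \<psi> (a * z ^ Q)) = (\<Sum>z\<in>UNIV. \<psi> (a * z))" for a
  proof -
    have "inj (\<lambda>z::'a. z ^ Q)"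
    proof (rule injI)
      fix x y :: 'a assume "x ^ Q = y ^ Q"
      moreover have "x ^ Q = (x - y) ^ Q + y ^ Q" using frob_add(1)[of "x - y" y] by simp
      ultimately show "x = y" using Q_ge by simp
    qed
    hence "bij (\<lambda>z::'a. z ^ Q)" by (simp add: finite_UNIV_inj_surj bij_def)
    thus ?thesis by (rule sum.reindex_bij_betw)
  qed
  \<comment> \<open>Replacing \<open>b * y ^ Q * z\<close> by its \<open>Q\<close>-th power under
    \<open>\<psi>\<close> makes both cross terms linear in \<open>z ^ Q\<close>.\<close>
  have split: "\<psi> (b * (z + y) ^ (Q + 1)) * \<psi> (- (b * z ^ (Q + 1))) =
      \<psi> (b * y ^ (Q + 1)) * \<psi> ((b ^ Q * y ^ (Q * Q) + b * y) * z ^ Q)" for y z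
  proof -
    have "\<psi> (b * (z + y) ^ (Q + 1)) * \<psi> (- (b * z ^ (Q + 1)))
        = \<psi> (b * (z + y) ^ (Q + 1) - b * z ^ (Q + 1))" by (simp add: psi_add[symmetric])
    also have "b * (z + y) ^ (Q + 1) - b * z ^ (Q + 1) = b * y ^ (Q + 1) + (b * y ^ Q * z + b * y * z ^ Q)"
      by (simp add: frob_add algebra_simps)
    also have "\<psi> \<dots> = \<psi> (b * y ^ (Q + 1)) * (\<psi> ((b * y ^ Q * z) ^ Q) * \<psi> (b * y * z ^ Q))"
      by (simp add: psi_add psi_frob)
    also have "(b * y ^ Q * z) ^ Q = b ^ Q * y ^ (Q * Q) * z ^ Q"
      by (simp add: power_mult_distrib power_mult[symmetric])
    finally show ?thesis by (simp add: psi_add distrib_right)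
  qed
  have "W b * cnj (W b) = (\<Sum>z\<in>UNIV. \<Sum>u\<in>UNIV. \<psi> (b * u ^ (Q + 1)) * \<psi> (- (b * z ^ (Q + 1))))"
    unfolding W_def by (simp add: sum_distrib_left sum_distrib_right cnj_psi)
  also have "\<dots> = (\<Sum>z\<in>UNIV. \<Sum>y\<in>UNIV. \<psi> (b * (z + y) ^ (Q + 1)) * \<psi> (- (b * z ^ (Q + 1))))"
  proof (rule sum.cong[OF refl])
    fix z
    show "(\<Sum>u\<in>UNIV. \<psi> (b * u ^ (Q + 1)) * \<psi> (- (b * z ^ (Q + 1))))
        = (\<Sum>y\<in>UNIV. \<psi> (b * (z + y) ^ (Q + 1)) * \<psi> (- (b * z ^ (Q + 1))))"
      by (rule sum.reindex_bij_witness[of _ "\<lambda>y. z + y" "\<lambda>u. u - z"]) auto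
  qed
  also have "\<dots> = (\<Sum>y\<in>UNIV. \<psi> (b * y ^ (Q + 1)) * (\<Sum>z\<in>UNIV. \<psi> ((b ^ Q * y ^ (Q * Q) + b * y) * z ^ Q)))"
    unfolding split by (subst sum.swap) (simp add: sum_distrib_left)
  also have "\<dots> = (\<Sum>y\<in>UNIV. if b ^ Q * y ^ (Q * Q) + b * y = 0 then of_nat CARD('a) else 0)"
    unfolding bij sum_psi by (intro sum.cong refl) (simp add: psi_eq_1_of_radical del: One_nat_def)
  also have "\<dots> = of_nat (CARD('a) * card ?R)"
    by (simp add: sum.If_cases)
  finally have "complex_of_real (w b ^ 2) = of_real (real CARD('a) * real (card ?R))"
    unfolding cnj_W by (simp add: W_eq_w power2_eq_square)
  thus ?thesis by (simp only: of_real_eq_iff)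
qed

definition U :: "'a set" where "U = (\<lambda>y. y ^ (Q + 1)) ` (UNIV - {0})"

lemma U_cofactor: obtains M where "M * (Q + 1) = CARD('a) - 1" "U = {x. x ^ M = 1}" "(Q - 1) dvd M"
proof -
  obtain u where u: "(2 * u) * ((Q - 1) * (Q + 1)) = CARD('a) - 1" using Q2_minus_1_cofactor .
  hence M: "((2 * u) * (Q - 1)) * (Q + 1) = CARD('a) - 1" by (simp only: mult_ac)
  have "U = {x. x ^ ((2 * u) * (Q - 1)) = 1}"
    unfolding root_of_unity_iff_nth_power[OF prim M] U_def by auto
  thus ?thesis using M that by simp
qed

text \<open>A nonzero \<open>y\<close> in the radical gives \<open>c = b y^(Q+1)\<close> with
  \<open>c ^ (Q - 1) = - 1\<close>. The element \<open>v ^ (Q + 1)\<close> has the same power, so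
  the quotient is a \<open>(Q - 1)\<close>-th root of unity and lies in \<open>U\<close>; then
  \<open>b\<close> lies in \<open>U\<close> too. Outside \<open>U\<close> the radical is therefore
  trivial.\<close>

lemma w_square_outside_U:
  assumes "b \<noteq> 0" "b \<notin> U"
  shows "w b ^ 2 = (real s)\<^sup>2"
proof -
  obtain M where M: "M * (Q + 1) = CARD('a) - 1" "U = {x. x ^ M = 1}" "(Q - 1) dvd M" using U_cofactor .
  have "y = 0" if y: "b ^ Q * y ^ (Q * Q) + b * y = 0" for y
  proof (rule ccontr)
    assume "y \<noteq> 0"
    obtain v :: 'a where v: "v \<noteq> 0" "v ^ ((Q - 1) * (Q + 1)) = - 1" using minus_one_power by blast
    obtain Q' where Q': "Q = Suc Q'" using Q_ge by (cases Q) auto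
    define c where "c = b * y ^ (Q + 1)"
    have "c ^ (Q - 1) * (b * y) = b ^ Q * y ^ (Q * Q)"
      unfolding c_def Q' by (simp add: power_mult_distrib power_mult[symmetric] power_add algebra_simps)
    also have "\<dots> = - (b * y)" using y by (simp add: eq_neg_iff_add_eq_0)
    finally have "c ^ (Q - 1) = - 1" using \<open>y \<noteq> 0\<close> assms(1)
      by (metis mult_cancel_right mult_eq_0_iff mult_minus1)
    moreover have "(v ^ (Q + 1)) ^ (Q - 1) = - 1"
      using v(2) by (simp only: power_mult[symmetric] mult.commute)
    ultimately have "(c / v ^ (Q + 1)) ^ (Q - 1) = 1"
      unfolding power_divide by simp
    hence "(c / v ^ (Q + 1)) ^ M = 1" using M(3) by (auto simp: dvd_def power_mult)
    moreover have "(b ^ M) = (c / v ^ (Q + 1)) ^ M * ((v / y) ^ (Q + 1)) ^ M"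
      using v \<open>y \<noteq> 0\<close> unfolding power_mult_distrib[symmetric] c_def by (simp add: power_divide)
    moreover have "((v / y) ^ (Q + 1)) ^ M = 1"
      unfolding power_mult[symmetric] using M(1) power_CARD_minus_1[of "v / y"] v \<open>y \<noteq> 0\<close>
      by (simp add: mult.commute)
    ultimately show False using assms M(2) by simp
  qed
  moreover have "b ^ Q * 0 ^ (Q * Q) + b * 0 = 0" using Q_ge by (simp add: power_0_left)
  ultimately have "{y. b ^ Q * y ^ (Q * Q) + b * y = 0} = {0}" by blast
  thus ?thesis unfolding w_square by (simp add: CARD_eq power2_eq_square)
qed

lemma w_in_U:
  assumes "b \<in> U"
  shows "w b = w 1"
proof -
  obtain y where "y \<noteq> 0" "b = 1 * y ^ (Q + 1)" using assms by (auto simp: U_def)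
  thus ?thesis unfolding w_def by (metis W_mult)
qed

text \<open>For \<open>b = 1\<close> the radical is 0 together with a coset of the
  \<open>(Q^2 - 1)\<close>-th roots of unity, so it has \<open>Q^2\<close> elements.\<close>

lemma w_1_square: "w 1 ^ 2 = (real s * real Q)\<^sup>2"
proof -
  obtain u where u: "(2 * u) * ((Q - 1) * (Q + 1)) = CARD('a) - 1" using Q2_minus_1_cofactor .
  let ?n = "(Q - 1) * (Q + 1)"
  obtain v :: 'a where v: "v \<noteq> 0" "v ^ ?n = - 1" using minus_one_power by blast
  have QQ: "Q * Q = Suc ?n" using Q_ge by (cases Q) auto
  have "{y::'a. 1 ^ Q * y ^ (Q * Q) + 1 * y = 0} = insert 0 {y. y ^ ?n = - 1}"
  proof -
    have "1 ^ Q * y ^ (Q * Q) + 1 * y = y * (y ^ ?n + 1)" for y :: 'a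
      unfolding QQ by (simp add: algebra_simps)
    thus ?thesis by (auto simp: eq_neg_iff_add_eq_0)
  qed
  also have "card \<dots> = Suc (card {y::'a. y ^ ?n = - 1})"
    using Q_ge by (subst card_insert_disjoint) (auto simp: power_0_left)
  also have "{y::'a. y ^ ?n = - 1} = (\<lambda>x. v * x) ` {x. x ^ ?n = 1}"
  proof (intro equalityI subsetI)
    fix y assume "y \<in> {y::'a. y ^ ?n = - 1}"
    hence "(y / v) ^ ?n = 1" using v by (simp add: power_divide)
    moreover have "y = v * (y / v)" using v by simp
    ultimately show "y \<in> (\<lambda>x. v * x) ` {x. x ^ ?n = 1}" by blast
  qed (use v in \<open>auto simp: power_mult_distrib\<close>)
  also have "card \<dots> = card {x::'a. x ^ ?n = 1}"
    using v by (intro card_image) (auto simp: inj_on_def)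
  also have "\<dots> = ?n" by (rule card_roots_of_unity[OF prim, of _ "2 * u"]) (use u in \<open>simp add: mult.commute\<close>)
  finally have "card {y::'a. 1 ^ Q * y ^ (Q * Q) + 1 * y = 0} = Q * Q" by (simp add: QQ)
  thus ?thesis unfolding w_square CARD_eq by (simp add: power2_eq_square)
qed

lemma psi_frob_s: "\<psi> (x ^ s) = \<psi> x"
proof -
  have "\<psi> (x ^ Q ^ n) = \<psi> x" for n
    by (induction n) (simp_all add: power_mult mult.commute[of Q] psi_frob)
  thus ?thesis by (simp add: s_def)
qed

section \<open>The subfield of order \<open>s\<close> and the signs of the sums\<close>

definition F where "F = {x::'a. x ^ s = x}"

lemma F_conv: "F = insert 0 {x. x ^ (s - 1) = 1}"
proof -
  have "x ^ s = x * x ^ (s - 1)" for x :: 'a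
    using s_ge by (metis Suc_diff_1 not_gr_zero not_numeral_le_zero power_Suc)
  thus ?thesis by (auto simp: F_def)
qed

lemma card_F: "card F = s"
proof -
  have "0 \<notin> {x::'a. x ^ (s - 1) = 1}" using s_ge by (simp add: power_0_left)
  moreover have "card {x::'a. x ^ (s - 1) = 1} = s - 1"
    by (rule card_roots_of_unity[OF prim CARD_minus_1])
  ultimately show ?thesis unfolding F_conv using s_ge by simp
qed

lemma F_closed:
  assumes "x \<in> F" "y \<in> F"
  shows "x + y \<in> F" "x * y \<in> F" "x / y \<in> F" "- x \<in> F" "x - y \<in> F"
proof -
  have 1: "x + y \<in> F" if "x \<in> F" "y \<in> F" for x y :: 'a
    using that frob_add by (simp add: F_def)
  have m: "- x \<in> F" if "x \<in> F" for x :: 'a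
    using that odd_s by (simp add: F_def)
  show "x * y \<in> F" "x / y \<in> F" using assms by (simp_all add: F_def power_mult_distrib power_divide)
  show "x + y \<in> F" "- x \<in> F" using 1 m assms by blast+
  show "x - y \<in> F" using 1[OF assms(1) m[OF assms(2)]] by simp
qed

lemma one_in_F: "1 \<in> F" and zero_in_F: "0 \<in> F"
  using s_ge by (auto simp: F_def power_0_left)

lemma power_s_s: "(x ^ s) ^ s = (x :: 'a)"
  using power_CARD_eq_self[of x] unfolding CARD_eq by (simp add: power_mult)

text \<open>\<open>z + z ^ s\<close> is the relative trace of \<open>z\<close> to \<open>F\<close>.
  When it is nonzero, \<open>F\<close>-multiples of \<open>z\<close> attain every relative trace, so
  \<open>\<psi>\<close> cannot be trivial on all of them without being trivial everywhere.\<close>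

lemma sum_psi_F:
  assumes "z + z ^ s \<noteq> 0"
  shows "(\<Sum>b\<in>F. \<psi> (b * z)) = 0"
proof -
  have "\<exists>b\<in>F. \<psi> (b * z) \<noteq> 1"
  proof (rule ccontr)
    assume "\<not> ?thesis"
    hence triv: "\<psi> (b * z) = 1" if "b \<in> F" for b using that by blast
    have "\<psi> x = 1" for x
    proof -
      \<comment> \<open>Halving compensates for
        \<open>\<psi> (y + y ^ s) = \<psi> (2 * y)\<close>.\<close>
      define y where "y = x / 2"
      have trace_F: "u + u ^ s \<in> F" for u :: 'a
        by (simp add: F_def frob_add power_s_s add.commute)
      define e where "e = (y + y ^ s) / (z + z ^ s)"
      have e: "e \<in> F" unfolding e_def by (rule F_closed(3)[OF trace_F trace_F])
      hence es: "e ^ s = e" by (simp add: F_def)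
      have "1 = \<psi> (e * z) * \<psi> ((e * z) ^ s)" using triv[OF e] by (simp add: psi_frob_s)
      also have "\<dots> = \<psi> (e * (z + z ^ s))"
        by (simp add: psi_add[symmetric] power_mult_distrib es distrib_left)
      also have "e * (z + z ^ s) = y + y ^ s" using assms by (simp add: e_def)
      also have "\<psi> \<dots> = \<psi> (y + y)" by (simp only: psi_add psi_frob_s)
      also have "y + y = x" using two_neq_0 by (simp add: y_def field_simps)
      finally show ?thesis by simp
    qed
    thus False using psi_nontrivial by blast
  qed
  then obtain b0 where b0: "b0 \<in> F" "\<psi> (b0 * z) \<noteq> 1" by blast
  have "\<psi> (b0 * z) * (\<Sum>b\<in>F. \<psi> (b * z)) = (\<Sum>b\<in>F. \<psi> ((b0 + b) * z))"
    by (simp add: sum_distrib_left distrib_right psi_add)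
  also have "\<dots> = (\<Sum>b\<in>F. \<psi> (b * z))"
    by (rule sum.reindex_bij_witness[of _ "\<lambda>b. b - b0" "\<lambda>b. b0 + b"]) (use b0 F_closed in auto)
  finally show ?thesis using b0 by simp
qed

text \<open>Parity: \<open>r\<close> even gives \<open>s \<equiv> 1\<close> modulo 4, so \<open>(s + 1)/2\<close> is odd, while \<open>Q + 1\<close> is even.\<close>

lemma trace_power_nonzero:
  fixes y :: 'a
  assumes "y \<noteq> 0"
  shows "y ^ (Q + 1) + (y ^ (Q + 1)) ^ s \<noteq> 0"
proof
  let ?z = "y ^ (Q + 1)"
  assume "?z + ?z ^ s = 0"
  hence "?z ^ s = - ?z" by (simp add: add_eq_0_iff)
  moreover have "?z ^ s = ?z * ?z ^ (s - 1)"
    using s_ge by (metis Suc_diff_1 not_gr_zero not_numeral_le_zero power_Suc)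
  ultimately have *: "?z ^ (s - 1) = - 1" using assms
    by (metis mult_cancel_left mult_minus1_right power_not_zero)
  obtain u where u: "s - 1 = (Q - 1) * (Q + 1) * u" using s_minus_1 .
  have "odd Q" using p by (simp add: Q_def)
  then obtain a where a: "Q = 2 * a + 1" by (rule oddE)
  have s: "s = 4 * (a * (a + 1) * u) + 1" using u s_ge unfolding a by (simp add: algebra_simps)
  define e where "e = 2 * (a * (a + 1) * u) + 1"
  have e: "s + 1 = 2 * e" "odd e" unfolding e_def using s by simp_all
  have "- 1 = (?z ^ (s - 1)) ^ e" unfolding * using e(2) by simp
  also have "\<dots> = y ^ ((Q + 1) * (s - 1) * e)" by (simp only: power_mult)
  also have "(Q + 1) * (s - 1) * e = (s - 1) * (s + 1) * (a + 1)" 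
  proof -
    have "(s - 1) * (s + 1) * (a + 1) = (s - 1) * (2 * e) * (a + 1)" unfolding e(1) ..
    also have "\<dots> = 2 * (a + 1) * (s - 1) * e" by (simp only: mult_ac)
    also have "2 * (a + 1) = Q + 1" unfolding a by simp
    finally show ?thesis ..
  qed
  also have "y ^ \<dots> = 1"
    unfolding CARD_minus_1 by (subst power_mult) (simp add: power_CARD_minus_1 assms del: One_nat_def)
  finally show False using two_neq_0 by (metis add.right_inverse one_add_one)
qed

text \<open>After exchanging the sums only \<open>y = 0\<close> survives, because
  \<open>y ^ (Q + 1)\<close> has nonzero relative trace for all other \<open>y\<close>.\<close>

lemma sum_W_F: "(\<Sum>b\<in>F. W b) = of_nat s"
proof -
  have "(\<Sum>b\<in>F. W b) = (\<Sum>y\<in>UNIV. \<Sum>b\<in>F. \<psi> (b * y ^ (Q + 1)))"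
    unfolding W_def by (rule sum.swap)
  also have "\<dots> = (\<Sum>y\<in>(UNIV :: 'a set). if y = 0 then of_nat s else 0)"
  proof (intro sum.cong refl)
    fix y :: 'a
    show "(\<Sum>b\<in>F. \<psi> (b * y ^ (Q + 1))) = (if y = 0 then of_nat s else 0)"
    proof (cases "y = 0")
      case False
      thus ?thesis using sum_psi_F[OF trace_power_nonzero[OF False]] by (simp only: if_False)
    qed (simp add: card_F)
  qed
  finally show ?thesis by simp
qed

lemma sum_W_UNIV: "(\<Sum>b\<in>UNIV. W b) = of_nat CARD('a)"
proof -
  have "(\<Sum>b\<in>UNIV. W b) = (\<Sum>y\<in>UNIV. \<Sum>b\<in>UNIV. \<psi> (b * y ^ (Q + 1)))"
    unfolding W_def by (rule sum.swap)
  also have "\<dots> = (\<Sum>y\<in>(UNIV :: 'a set). if y = 0 then of_nat CARD('a) else 0)"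
    unfolding sum_psi' by (intro sum.cong refl) auto
  finally show ?thesis by simp
qed

lemma U_subset: "U \<subseteq> UNIV - {0}"
  by (auto simp: U_def)

lemma card_U: "card U * (Q + 1) = CARD('a) - 1"
proof -
  obtain M where M: "M * (Q + 1) = CARD('a) - 1" "U = {x. x ^ M = 1}" using U_cofactor .
  thus ?thesis using card_roots_of_unity[OF prim M(1)] by simp
qed

text \<open>With the opposite sign all \<open>w b\<close> for \<open>b \<noteq> 0\<close> are at least \<open>- s\<close>, and the sum over \<open>F\<close> exceeds
its known value \<open>s\<close>.\<close>

lemma w_1: "w 1 = - (real s * real Q)"
proof (rule ccontr)
  assume "w 1 \<noteq> - (real s * real Q)"
  moreover have "w 1 = real s * real Q \<or> w 1 = - (real s * real Q)"
    using w_1_square by (simp only: power2_eq_iff)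
  ultimately have w1: "w 1 = real s * real Q" by blast
  have lb: "w b \<ge> - real s" if "b \<noteq> 0" for b
  proof (cases "b \<in> U")
    case True
    have "0 \<le> real s * real Q" "0 \<le> real s" by simp_all
    thus ?thesis using w1 w_in_U[OF True] by linarith
  next
    case False
    thus ?thesis using w_square_outside_U[OF that False] by (auto simp: power2_eq_iff)
  qed
  have "complex_of_real (\<Sum>b\<in>F. w b) = of_real (real s)"
    using sum_W_F by (simp add: W_eq_w)
  hence "real s = (\<Sum>b\<in>F. w b)" by (simp only: of_real_eq_iff)
  also have "\<dots> = w 0 + (w 1 + (\<Sum>b\<in>F - {0} - {1}. w b))"
    by (subst sum.remove[of _ 0], simp, simp add: zero_in_F, subst sum.remove[of _ 1])
      (auto simp: one_in_F)
  also have "w 0 = real s * real s" by (simp add: w_def W_0 CARD_eq)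
  also have "(\<Sum>b\<in>F - {0} - {1}. w b) \<ge> (\<Sum>b\<in>F - {0} - {1}. - real s)"
    by (intro sum_mono lb) auto
  moreover have "card (F - {0} - {1}) = s - 2"
    by (simp add: card_F zero_in_F one_in_F)
  moreover have "real (s - 2) = real s - 2" using s_ge by simp
  ultimately have "real s \<ge> real s * real s + (real s * real Q - (real s - 2) * real s)"
    using w1 by simp
  hence "real s * real Q + real s \<le> 0" by (simp add: algebra_simps)
  moreover have "real s * real Q \<ge> 0" "real s > 0" using s_ge by auto
  ultimately show False by linarith
qed

text \<open>Once \<open>w 1\<close> is known, the total over all \<open>b\<close> forces the average
  of \<open>w\<close> outside \<open>U\<close> and 0 to be \<open>s\<close>, which is also its
  maximum there.\<close>

lemma w_outside_U:
  assumes "b \<noteq> 0" "b \<notin> U"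
  shows "w b = real s"
proof -
  let ?V = "UNIV - {0} - U"
  have "complex_of_real (\<Sum>b\<in>UNIV. w b) = of_real (real CARD('a))"
    using sum_W_UNIV by (simp add: W_eq_w)
  hence "real CARD('a) = (\<Sum>b\<in>UNIV. w b)" by (simp only: of_real_eq_iff)
  also have "\<dots> = w 0 + ((\<Sum>b\<in>U. w b) + (\<Sum>b\<in>?V. w b))"
    using U_subset by (simp add: sum.remove[of UNIV 0] sum.subset_diff[of U "UNIV - {0}"])
  also have "w 0 = real CARD('a)" by (simp add: w_def W_0)
  also have "(\<Sum>b\<in>U. w b) = real (card U) * w 1" by (simp add: w_in_U)
  finally have "(\<Sum>b\<in>?V. w b) = real (card U) * (real s * real Q)" by (simp add: w_1)
  moreover have "card ?V = card U * Q"
    using card_U U_subset by (simp add: card_Diff_subset)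
  ultimately have "(\<Sum>b\<in>?V. real s - w b) = 0" by (simp add: sum_subtractf)
  moreover have "real s - w b \<ge> 0" if "b \<in> ?V" for b
    using w_square_outside_U[of b] that by (auto simp: power2_eq_iff)
  ultimately have "\<forall>b\<in>?V. real s - w b = 0" by (subst (asm) sum_nonneg_eq_0_iff) auto
  thus ?thesis using assms by auto
qed

section \<open>Cyclotomic classes and Gauss periods of order \<open>2d\<close>\<close>

definition C where "C j = cyclotomic_class g (2 * d) j"

lemma class_cofactor: obtains M where "M * (2 * d) = CARD('a) - 1"
proof -
  obtain k where k: "Q + 1 = 2 * d * k" using dvd_Q unfolding Q_def by blast
  have "card U * k * (2 * d) = CARD('a) - 1" 
    unfolding card_U[symmetric] k by (simp only: mult_ac)
  thus ?thesis using that by blast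
qed

lemma C_0: "M * (2 * d) = CARD('a) - 1 \<Longrightarrow> C 0 = {x. x ^ M = 1}"
  by (auto simp: C_def mem_cyclotomic_class_iff[OF prim])

lemma zero_notin_C: "0 \<notin> C j"
proof -
  obtain M where M: "M * (2 * d) = CARD('a) - 1" using class_cofactor .
  hence "M > 0" using CARD_field_gt_1[where 'a='a] by (cases M) auto
  thus ?thesis using M by (simp add: C_def mem_cyclotomic_class_iff[OF prim] power_0_left)
qed

lemma C_0_closed: "x \<in> C 0 \<Longrightarrow> y \<in> C 0 \<Longrightarrow> x * y \<in> C 0" "x \<in> C 0 \<Longrightarrow> y \<in> C 0 \<Longrightarrow> x / y \<in> C 0"
  "1 \<in> C 0"
proof -
  obtain M where M: "M * (2 * d) = CARD('a) - 1" using class_cofactor .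
  show "x \<in> C 0 \<Longrightarrow> y \<in> C 0 \<Longrightarrow> x * y \<in> C 0" "x \<in> C 0 \<Longrightarrow> y \<in> C 0 \<Longrightarrow> x / y \<in> C 0"
    "1 \<in> C 0" using M by (auto simp: C_0 power_mult_distrib power_divide)
qed

lemma U_subset_C_0: "U \<subseteq> C 0"
proof
  fix x assume "x \<in> U"
  then obtain y where y: "y \<noteq> 0" "x = y ^ (Q + 1)" by (auto simp: U_def)
  obtain k where k: "Q + 1 = 2 * d * k" using dvd_Q unfolding Q_def by blast
  obtain M where M: "M * (2 * d) = CARD('a) - 1" using class_cofactor .
  have "x ^ M = y ^ (M * (2 * d) * k)" unfolding y k by (simp only: power_mult[symmetric] mult_ac)
  also have "\<dots> = 1" unfolding M using y by (simp add: power_mult power_CARD_minus_1 del: One_nat_def)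
  finally show "x \<in> C 0" using M by (simp add: C_0)
qed

lemma minus_1_in_C_0: "- 1 \<in> C 0"
proof -
  obtain v :: 'a where v: "v \<noteq> 0" "v ^ ((Q - 1) * (Q + 1)) = - 1" using minus_one_power by blast
  hence "(v ^ (Q - 1)) ^ (Q + 1) = - 1" by (simp only: power_mult)
  hence "- 1 \<in> U" unfolding U_def using v(1) by (intro image_eqI[of _ _ "v ^ (Q - 1)"]) auto
  thus ?thesis using U_subset_C_0 by blast
qed

lemma C_conv: "C j = (\<lambda>x. g ^ j * x) ` C 0"
  by (simp add: C_def cyclotomic_class_def)

lemma card_C_0: "card (C 0) * (2 * d) = CARD('a) - 1"
proof -
  obtain M where M: "M * (2 * d) = CARD('a) - 1" using class_cofactor .
  thus ?thesis using card_roots_of_unity[OF prim M] by (simp add: C_0)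
qed

lemma g_nonzero: "g \<noteq> 0"
  using primitive_root_nonzero[OF prim] .

lemma card_C: "card (C j) = card (C 0)"
  unfolding C_conv[of j] using g_nonzero by (intro card_image) (auto simp: inj_on_def)

lemma real_card_C_0: "real (card (C 0)) = (real s - 1) * (real s + 1) / real (2 * d)"
proof -
  have "real (card (C 0)) * real (2 * d) = real ((s - 1) * (s + 1))"
    unfolding CARD_minus_1 card_C_0[symmetric] by simp
  also have "\<dots> = (real s - 1) * (real s + 1)" using s_ge by (simp add: of_nat_diff algebra_simps)
  finally show ?thesis using d_pos by (simp add: field_simps)
qed

text \<open>The Gauss periods, that is, the eigenvalues of the Cayley graph with connection set
  \<open>C j\<close>.\<close>

definition \<eta> :: "nat \<Rightarrow> 'a \<Rightarrow> complex" where "\<eta> j b = (\<Sum>z\<in>C j. \<psi> (b * z))"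

text \<open>Sum \<open>W (a * z)\<close> over \<open>z\<close> in \<open>C 0\<close>. Each nonzero
  \<open>y\<close> contributes the same period, because \<open>y ^ (Q + 1)\<close> permutes
  \<open>C 0\<close> by multiplication; on the other side the values of \<open>w\<close> are known,
  and \<open>a * z\<close> can meet \<open>U\<close> only if \<open>a\<close> is in
  \<open>C 0\<close>.\<close>

lemma eta_0:
  assumes "a \<noteq> 0"
  shows "\<eta> 0 a = of_real ((real s - 1) / real (2 * d) - (if a \<in> C 0 then real s else 0))"
proof -
  let ?M = "real (card (C 0))" and ?n = "(real s - 1) * (real s + 1)"
  have n: "real (CARD('a) - 1) = ?n"
    unfolding CARD_minus_1[symmetric] using s_ge by (simp add: of_nat_diff algebra_simps)
  have n0: "?n > 0" using s_ge by simp
  have shift: "(\<Sum>z\<in>C 0. \<psi> (a * z * y ^ (Q + 1))) = \<eta> 0 a" if "y \<noteq> 0" for y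
  proof -
    have y: "y ^ (Q + 1) \<in> C 0" using that U_subset_C_0 by (auto simp: U_def)
    show ?thesis unfolding \<eta>_def
      by (rule sum.reindex_bij_witness[of _ "\<lambda>z. z / y ^ (Q + 1)" "\<lambda>z. z * y ^ (Q + 1)"])
        (use y that C_0_closed in \<open>auto simp: mult.assoc simp del: power_Suc\<close>)
  qed
  have "(\<Sum>z\<in>C 0. W (a * z)) = (\<Sum>y\<in>UNIV. \<Sum>z\<in>C 0. \<psi> (a * z * y ^ (Q + 1)))"
    unfolding W_def by (rule sum.swap)
  also have "\<dots> = of_real ?M + (\<Sum>y\<in>UNIV - {0}. \<Sum>z\<in>C 0. \<psi> (a * z * y ^ (Q + 1)))"
    by (simp add: sum.remove[of UNIV 0])
  also have "\<dots> = of_real ?M + of_real (real (CARD('a) - 1)) * \<eta> 0 a"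
  proof -
    have "(\<Sum>y\<in>UNIV - {0}. \<Sum>z\<in>C 0. \<psi> (a * z * y ^ (Q + 1))) = (\<Sum>y\<in>UNIV - {0::'a}. \<eta> 0 a)"
      by (intro sum.cong refl shift) auto
    thus ?thesis by simp
  qed
  finally have sum: "(\<Sum>z\<in>C 0. W (a * z)) = of_real ?M + of_real ?n * \<eta> 0 a" unfolding n .
  have cancel: "\<eta> 0 a = of_real x" if "of_real ?n * \<eta> 0 a = of_real (?n * x)" for x
    using that n0 by (metis less_irrefl mult_left_cancel of_real_eq_0_iff of_real_mult)
  show ?thesis
  proof (cases "a \<in> C 0")
    case False
    have "w (a * z) = real s" if z: "z \<in> C 0" for z
    proof (rule w_outside_U)
      show nz: "a * z \<noteq> 0" using assms z zero_notin_C by auto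
      show "a * z \<notin> U" using U_subset_C_0 C_0_closed(2)[of "a * z" z] False z nz by auto
    qed
    hence "(\<Sum>z\<in>C 0. W (a * z)) = of_real (?M * real s)" by (simp add: W_eq_w)
    hence "of_real ?n * \<eta> 0 a = of_real (?M * (real s - 1))"
      using sum by (simp add: algebra_simps)
    hence "of_real ?n * \<eta> 0 a = of_real (?n * ((real s - 1) / real (2 * d)))"
      unfolding real_card_C_0 by simp
    from cancel[OF this] show ?thesis using False by simp
  next
    case True
    have "(\<Sum>z\<in>C 0. W (a * z)) = (\<Sum>z\<in>C 0. W z)"
      by (rule sum.reindex_bij_witness[of _ "\<lambda>z. z / a" "\<lambda>z. a * z"])
        (use assms True C_0_closed in auto)
    also have "\<dots> = of_real ((\<Sum>z\<in>C 0 - U. w z) + (\<Sum>z\<in>U. w z))"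
      using U_subset_C_0 by (simp add: W_eq_w sum.subset_diff[of U "C 0"])
    also have "(\<Sum>z\<in>C 0 - U. w z) = (\<Sum>z\<in>C 0 - U. real s)"
      using zero_notin_C by (intro sum.cong refl w_outside_U) auto
    also have "\<dots> = real s * (?M - real (card U))"
      using U_subset_C_0 by (simp add: card_Diff_subset card_mono of_nat_diff)
    also have "(\<Sum>z\<in>U. w z) = - real (card U) * (real s * real Q)"
      by (simp add: w_in_U w_1)
    also have "real s * (?M - real (card U)) + \<dots> = real s * (?M - real (card U * (Q + 1)))"
      by (simp add: algebra_simps)
    also have "\<dots> = real s * (?M - ?n)" unfolding card_U n ..
    finally have "of_real ?M + of_real ?n * \<eta> 0 a = of_real (real s * (?M - ?n))"
      unfolding sum .
    hence "of_real ?n * \<eta> 0 a = of_real (real s * (?M - ?n) - ?M)"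
      by (metis add_diff_cancel_left' of_real_diff)
    also have "real s * (?M - ?n) - ?M = ?M * (real s - 1) - ?n * real s"
      by (simp add: algebra_simps)
    also have "\<dots> = ?n * ((real s - 1) / real (2 * d) - real s)"
      unfolding real_card_C_0 by (simp add: right_diff_distrib diff_divide_distrib)
    finally have "of_real ?n * \<eta> 0 a = of_real (?n * ((real s - 1) / real (2 * d) - real s))" .
    from cancel[OF this] show ?thesis using True by simp
  qed
qed

lemma eta_shift: "\<eta> j b = \<eta> 0 (b * g ^ j)"
  unfolding \<eta>_def C_conv[of j] using g_nonzero
  by (subst sum.reindex) (auto simp: inj_on_def mult.assoc)

section \<open>Fourier transform of a clique\<close>

definition eta_re :: "nat \<Rightarrow> 'a \<Rightarrow> real" where
  "eta_re j b = (if b = 0 then real (card (C 0))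
    else (real s - 1) / real (2 * d) - (if b * g ^ j \<in> C 0 then real s else 0))"

lemma eta_eq: "\<eta> j b = of_real (eta_re j b)"
proof (cases "b = 0")
  case True
  thus ?thesis by (simp add: \<eta>_def eta_re_def card_C[of j])
next
  case False
  thus ?thesis using eta_0[of "b * g ^ j"] g_nonzero by (simp add: eta_re_def eta_shift[of j])
qed

text \<open>Fourier inversion for the indicator function of \<open>C j\<close>.\<close>

lemma sum_eta_psi: "(\<Sum>b\<in>UNIV. \<eta> j b * \<psi> (- (b * u))) = (if u \<in> C j then of_nat CARD('a) else 0)"
proof -
  have "(\<Sum>b\<in>UNIV. \<eta> j b * \<psi> (- (b * u))) = (\<Sum>b\<in>UNIV. \<Sum>z\<in>C j. \<psi> (b * (z - u)))"
    by (simp add: \<eta>_def sum_distrib_right psi_add[symmetric] right_diff_distrib)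
  also have "\<dots> = (\<Sum>z\<in>C j. if z = u then of_nat CARD('a) else 0)"
    by (subst sum.swap) (simp add: sum_psi')
  finally show ?thesis by simp
qed

definition fourier :: "'a set \<Rightarrow> 'a \<Rightarrow> complex" where
  "fourier K b = (\<Sum>x\<in>K. \<psi> (b * x))"

lemma fourier_0: "fourier K 0 = of_nat (card K)"
  by (simp add: fourier_def)

lemma cmod_fourier_square:
  "complex_of_real (cmod (fourier K b) ^ 2) = (\<Sum>x\<in>K. \<Sum>y\<in>K. \<psi> (- (b * (y - x))))"
proof -
  have "complex_of_real (cmod (fourier K b) ^ 2) = fourier K b * cnj (fourier K b)"
    by (rule complex_norm_square)
  also have "\<dots> = (\<Sum>x\<in>K. \<Sum>y\<in>K. \<psi> (b * x) * \<psi> (- (b * y)))"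
    by (simp add: fourier_def sum_product cnj_psi)
  finally show ?thesis by (simp add: psi_add[symmetric] right_diff_distrib)
qed

lemma parseval: "(\<Sum>b\<in>UNIV. cmod (fourier K b) ^ 2) = real CARD('a) * real (card K)"
proof -
  have "complex_of_real (\<Sum>b\<in>UNIV. cmod (fourier K b) ^ 2)
      = (\<Sum>b\<in>UNIV. \<Sum>x\<in>K. \<Sum>y\<in>K. \<psi> (b * (x - y)))"
    unfolding of_real_sum cmod_fourier_square by (simp add: algebra_simps)
  also have "\<dots> = (\<Sum>x\<in>K. \<Sum>y\<in>K. \<Sum>b\<in>UNIV. \<psi> (b * (x - y)))"
    by (rule sum_rotate)
  also have "\<dots> = of_real (real CARD('a) * real (card K))"
    by (simp add: sum_psi')
  finally show ?thesis by (simp only: of_real_eq_iff)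
qed

text \<open>Turns the number of ordered pairs of \<open>K\<close> with difference in
  \<open>C j\<close> into a weighted sum of the Gauss periods.\<close>

lemma sum_fourier_eta:
  "(\<Sum>b\<in>UNIV. cmod (fourier K b) ^ 2 * eta_re j b)
    = (\<Sum>x\<in>K. \<Sum>y\<in>K. if y - x \<in> C j then real CARD('a) else 0)"
proof -
  have "complex_of_real (\<Sum>b\<in>UNIV. cmod (fourier K b) ^ 2 * eta_re j b)
      = (\<Sum>b\<in>UNIV. \<Sum>x\<in>K. \<Sum>y\<in>K. \<eta> j b * \<psi> (- (b * (y - x))))"
    unfolding of_real_sum of_real_mult cmod_fourier_square eta_eq[symmetric]
    by (simp add: sum_distrib_left sum_distrib_right mult.commute)
  also have "\<dots> = (\<Sum>x\<in>K. \<Sum>y\<in>K. \<Sum>b\<in>UNIV. \<eta> j b * \<psi> (- (b * (y - x))))"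
    by (rule sum_rotate)
  also have "\<dots> = of_real (\<Sum>x\<in>K. \<Sum>y\<in>K. if y - x \<in> C j then real CARD('a) else 0)"
    unfolding sum_eta_psi of_real_sum by (intro sum.cong refl) auto
  finally show ?thesis by (simp only: of_real_eq_iff)
qed

context
  fixes I :: "nat set" and K :: "'a set"
  assumes I: "card I = d" "0 \<in> I"
    and card_K: "card K = s"
    and clique: "\<And>x y. x \<in> K \<Longrightarrow> y \<in> K \<Longrightarrow> x \<noteq> y \<Longrightarrow> x - y \<in> (\<Union>j\<in>I. C j)"
begin

text \<open>Counting the differences of \<open>K\<close> class by class on the Fourier side gives
\<open>s\<^sup>3 (s - 1) - s (\<Sum>j\<in>I. P j)\<close> with nonnegative \<open>P j\<close>, whereas the clique property gives at least
\<open>s\<^sup>3 (s - 1)\<close>.\<close>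

lemma fourier_vanishes:
  assumes b: "b \<in> C 0"
  shows "fourier K b = 0"
proof -
  define H where "H b = cmod (fourier K b) ^ 2" for b
  have H_nonneg: "H b \<ge> 0" for b by (simp add: H_def)
  have finI: "finite I" using I d_pos by (metis card.infinite not_gr_zero)
  define P where "P j = (\<Sum>b\<in>UNIV - {0}. if b * g ^ j \<in> C 0 then H b else 0)" for j
  \<comment> \<open>The value that each class would contribute if all periods at
    \<open>b \<noteq> 0\<close> were \<open>(s - 1)/2d\<close>; \<open>d\<close> such values add up
    to exactly \<open>s^3 (s - 1)\<close>.\<close>
  define B where "B = real s ^ 2 * real (card (C 0)) + (real s ^ 3 - real s ^ 2) * ((real s - 1) / real (2 * d))"
  have H_0: "H 0 = real s ^ 2" by (simp add: H_def fourier_0 card_K)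
  have "(\<Sum>b\<in>UNIV. H b) = real s ^ 3"
    unfolding H_def parseval card_K CARD_eq by (simp add: power3_eq_cube)
  hence sum_H: "(\<Sum>b\<in>UNIV - {0}. H b) = real s ^ 3 - real s ^ 2"
    by (simp add: sum.remove[of UNIV 0] H_0)
  have T: "(\<Sum>b\<in>UNIV. H b * eta_re j b) = B - real s * P j" for j
  proof -
    have "(\<Sum>b\<in>UNIV. H b * eta_re j b) = H 0 * eta_re j 0 + (\<Sum>b\<in>UNIV - {0}. H b * eta_re j b)"
      by (simp add: sum.remove[of UNIV 0])
    also have "(\<Sum>b\<in>UNIV - {0}. H b * eta_re j b)
        = (\<Sum>b\<in>UNIV - {0}. H b * ((real s - 1) / real (2 * d)) - real s * (if b * g ^ j \<in> C 0 then H b else 0))"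
      by (intro sum.cong refl) (auto simp: eta_re_def right_diff_distrib)
    also have "\<dots> = (\<Sum>b\<in>UNIV - {0}. H b) * ((real s - 1) / real (2 * d)) - real s * P j"
      by (simp add: sum_subtractf sum_distrib_right sum_distrib_left sum_divide_distrib P_def)
    finally show ?thesis by (simp add: sum_H H_0 B_def eta_re_def)
  qed
  have P_nonneg: "P j \<ge> 0" for j unfolding P_def by (intro sum_nonneg) (auto simp: H_nonneg)
  have sp: "real s > 0" using s_ge by simp
  have "real s ^ 2 * (real s * (real s - 1)) = (\<Sum>x\<in>K. \<Sum>y\<in>K. if y = x then 0 else real s ^ 2)"
  proof -
    have "(\<Sum>y\<in>K. if y = x then 0 else real s ^ 2) = (real s - 1) * real s ^ 2" if "x \<in> K" for x
    proof -
      have "(\<Sum>y\<in>K. if y = x then 0 else real s ^ 2) = (\<Sum>y\<in>K - {x}. real s ^ 2)"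
        using that by (simp add: sum.remove[of K x])
      thus ?thesis using that s_ge by (simp add: card_K of_nat_diff)
    qed
    thus ?thesis by (simp add: card_K)
  qed
  also have "\<dots> \<le> (\<Sum>x\<in>K. \<Sum>y\<in>K. \<Sum>j\<in>I. if y - x \<in> C j then real CARD('a) else 0)"
  proof (intro sum_mono)
    fix x y assume xy: "x \<in> K" "y \<in> K"
    show "(if y = x then 0 else real s ^ 2) \<le> (\<Sum>j\<in>I. if y - x \<in> C j then real CARD('a) else 0)"
    proof (cases "y = x")
      case False
      then obtain j where j: "j \<in> I" "y - x \<in> C j" using clique xy by blast
      have "real s ^ 2 = (if y - x \<in> C j then real CARD('a) else 0)"
        using j by (simp add: CARD_eq power2_eq_square)
      also have "\<dots> \<le> (\<Sum>j\<in>I. if y - x \<in> C j then real CARD('a) else 0)"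
        by (rule member_le_sum) (use j finI in auto)
      finally show ?thesis using False by simp
    qed (simp add: sum_nonneg)
  qed
  also have "\<dots> = (\<Sum>j\<in>I. \<Sum>x\<in>K. \<Sum>y\<in>K. if y - x \<in> C j then real CARD('a) else 0)"
    by (subst (2) sum.swap, subst sum.swap, rule refl)
  also have "\<dots> = (\<Sum>j\<in>I. B - real s * P j)"
    unfolding sum_fourier_eta[symmetric] using T by (simp add: H_def)
  also have "\<dots> = (B - real s * P 0) + (\<Sum>j\<in>I - {0}. B - real s * P j)"
    using I finI by (simp add: sum.remove[of I 0])
  \<comment> \<open>All \<open>P j\<close> except \<open>P 0\<close> are dropped: index 0 belongs to
    \<open>I\<close>, and \<open>P 0\<close> collects the mass of the transform on
    \<open>C 0\<close>.\<close>
  also have "\<dots> \<le> (B - real s * P 0) + (\<Sum>j\<in>I - {0}. B)"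
    using P_nonneg sp by (intro add_left_mono sum_mono) simp
  also have "\<dots> = real d * B - real s * P 0"
    using I finI d_pos by (simp add: of_nat_diff algebra_simps)
  also have "real d * B = real s ^ 2 * (real s * (real s - 1))"
    unfolding B_def real_card_C_0 using d_pos
    by (simp add: field_simps power2_eq_square power3_eq_cube)
  finally have "real s * P 0 \<le> 0" by simp
  hence "P 0 \<le> 0" using sp by (simp add: mult_le_0_iff)
  hence "P 0 = 0" using P_nonneg[of 0] by linarith
  hence "\<forall>b\<in>UNIV - {0}. (if b * g ^ 0 \<in> C 0 then H b else 0) = 0"
    unfolding P_def by (subst (asm) sum_nonneg_eq_0_iff) (auto simp: H_nonneg)
  moreover have "b \<noteq> 0" using b zero_notin_C by auto
  ultimately have "(if b * g ^ 0 \<in> C 0 then H b else 0) = 0" by blast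
  hence "H b = 0" using b by simp
  thus ?thesis by (simp add: H_def)
qed

text \<open>Count the neighbours by Fourier inversion. As the transform vanishes on
  \<open>C 0\<close>, the period may be replaced by the constant \<open>(s - 1)/2d\<close> at all
  nonzero frequencies, and inverting the transform of \<open>K\<close> at \<open>y\<close> evaluates
  the rest.\<close>

lemma card_class_neighbours:
  assumes y: "y \<in> K"
  shows "card {x \<in> K. x - y \<in> C 0} * d = s - 1"
proof -
  let ?c = "(real s - 1) / real (2 * d)"
  let ?f = "\<lambda>b. \<psi> (b * y) * cnj (fourier K b)"
  have "complex_of_real (real CARD('a) * real (card {x \<in> K. x - y \<in> C 0}))
      = (\<Sum>x\<in>K. if x - y \<in> C 0 then of_nat CARD('a) else 0)"
    by (simp add: sum.If_cases Int_def mult.commute)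
  also have "\<dots> = (\<Sum>x\<in>K. \<Sum>b\<in>UNIV. \<eta> 0 b * \<psi> (- (b * (x - y))))"
    unfolding sum_eta_psi ..
  also have "\<dots> = (\<Sum>b\<in>UNIV. \<Sum>x\<in>K. \<eta> 0 b * \<psi> (- (b * (x - y))))"
    by (rule sum.swap)
  also have "\<dots> = (\<Sum>b\<in>UNIV. \<eta> 0 b * ?f b)"
    by (simp add: fourier_def cnj_psi sum_distrib_left psi_add[symmetric] right_diff_distrib)
  also have "\<dots> = \<eta> 0 0 * ?f 0 + (\<Sum>b\<in>UNIV - {0}. \<eta> 0 b * ?f b)"
    by (simp add: sum.remove[of UNIV 0])
  also have "(\<Sum>b\<in>UNIV - {0}. \<eta> 0 b * ?f b) = (\<Sum>b\<in>UNIV - {0}. of_real ?c * ?f b)"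
  proof (intro sum.cong refl)
    fix b :: 'a assume "b \<in> UNIV - {0}"
    thus "\<eta> 0 b * ?f b = of_real ?c * ?f b"
      using fourier_vanishes[of b] by (cases "b \<in> C 0") (simp_all add: eta_0)
  qed
  also have "\<dots> = of_real ?c * (\<Sum>b\<in>UNIV - {0}. ?f b)"
    by (rule sum_distrib_left[symmetric])
  also have "(\<Sum>b\<in>UNIV - {0}. ?f b) = (\<Sum>b\<in>UNIV. ?f b) - ?f 0"
    by (simp add: sum.remove[of UNIV 0])
  also have "(\<Sum>b\<in>UNIV. ?f b) = (\<Sum>b\<in>UNIV. \<Sum>x\<in>K. \<psi> (b * (y - x)))"
    by (simp add: fourier_def cnj_psi sum_distrib_left psi_add[symmetric] right_diff_distrib)
  also have "\<dots> = of_nat CARD('a)"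
    by (subst sum.swap) (simp add: sum_psi' y)
  also have "?f 0 = of_real (real s)" by (simp add: fourier_0 card_K)
  also have "\<eta> 0 0 = of_real (real (card (C 0)))" by (simp add: eta_eq eta_re_def)
  also have "of_real (real (card (C 0))) * of_real (real s) + of_real ?c * (of_nat CARD('a) - of_real (real s))
      = complex_of_real (real (card (C 0)) * real s + ?c * (real CARD('a) - real s))"
    by simp
  finally have "real CARD('a) * real (card {x \<in> K. x - y \<in> C 0})
      = real (card (C 0)) * real s + ?c * (real CARD('a) - real s)"
    by (simp only: of_real_eq_iff)
  also have "\<dots> = real s * real s * ((real s - 1) / real d)"
    unfolding real_card_C_0 CARD_eq using d_pos by (simp add: field_simps)
  finally have "real (card {x \<in> K. x - y \<in> C 0}) = (real s - 1) / real d"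
    unfolding CARD_eq of_nat_mult by (subst (asm) mult_left_cancel) (use s_ge in auto)
  hence "real (card {x \<in> K. x - y \<in> C 0} * d) = real (s - 1)"
    using d_pos s_ge by (simp add: field_simps of_nat_diff)
  thus ?thesis by (simp only: of_nat_eq_iff)
qed

end

section \<open>Affine symmetries of a unique clique\<close>

lemma C_mult: "c \<in> C 0 \<Longrightarrow> z \<in> C j \<Longrightarrow> c * z \<in> C j"
  unfolding C_conv[of j] using C_0_closed(1) by (auto simp: mult.left_commute)

lemma dvd_s_minus_1: "2 * d dvd s - 1"
proof -
  obtain u where u: "s - 1 = (Q - 1) * (Q + 1) * u" using s_minus_1 .
  have "2 * d dvd Q + 1" using dvd_Q by (simp add: Q_def)
  thus ?thesis unfolding u by (intro dvd_mult2 dvd_mult)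
qed

definition difference_clique :: "nat set \<Rightarrow> 'a set \<Rightarrow> bool" where
  "difference_clique I K \<longleftrightarrow> (\<forall>x\<in>K. \<forall>y\<in>K. x \<noteq> y \<longrightarrow> x - y \<in> (\<Union>j\<in>I. C j))"

text \<open>Translations keep differences, and scaling by an element of \<open>C 0\<close> maps each
  class to itself.\<close>

lemma difference_clique_normalize:
  assumes K: "difference_clique I K" "card K = s" and xy: "x \<in> K" "y \<in> K" "x - y \<in> C 0"
  defines "K' \<equiv> (\<lambda>z. (z - y) / (x - y)) ` K"
  shows "difference_clique I K'" "card K' = s" "{0, 1} \<subseteq> K'"
proof -
  have nz: "x - y \<noteq> 0" using xy zero_notin_C by metis
  show "card K' = s"
    unfolding K'_def K(2)[symmetric] using nz by (intro card_image) (auto simp: inj_on_def)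
  have "0 \<in> K'" unfolding K'_def using xy by (intro image_eqI[of _ _ y]) auto
  moreover have "1 \<in> K'" unfolding K'_def using xy nz by (intro image_eqI[of _ _ x]) auto
  ultimately show "{0, 1} \<subseteq> K'" by blast
  show "difference_clique I K'" unfolding difference_clique_def
  proof (intro ballI impI)
    fix a b assume ab: "a \<in> K'" "b \<in> K'" "a \<noteq> b"
    then obtain u v where uv: "u \<in> K" "v \<in> K" "a = (u - y) / (x - y)" "b = (v - y) / (x - y)"
      by (auto simp: K'_def)
    hence "u \<noteq> v" using ab(3) by metis
    hence "u - v \<in> (\<Union>j\<in>I. C j)" using K(1) uv(1,2) unfolding difference_clique_def by simp
    then obtain j where j: "j \<in> I" "u - v \<in> C j" by blast
    have "1 / (x - y) \<in> C 0" using C_0_closed xy by blast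
    hence "1 / (x - y) * (u - v) \<in> C j" using j by (intro C_mult)
    also have "1 / (x - y) * (u - v) = a - b" unfolding uv by (simp flip: diff_divide_distrib)
    finally show "a - b \<in> (\<Union>j\<in>I. C j)" using j by blast
  qed
qed

context
  fixes I :: "nat set" and K :: "'a set"
  assumes I: "card I = d" "0 \<in> I"
    and K: "difference_clique I K" "card K = s" "{0, 1} \<subseteq> K"
    and unique: "\<And>K'. difference_clique I K' \<Longrightarrow> card K' = s \<Longrightarrow> {0, 1} \<subseteq> K' \<Longrightarrow> K' = K"
begin

text \<open>The affine map sending \<open>y\<close> to 0 and \<open>x\<close> to 1 yields another
  clique through 0 and 1, which uniqueness identifies with \<open>K\<close>.\<close>

lemma clique_affine:
  assumes "x \<in> K" "y \<in> K" "x - y \<in> C 0" "z \<in> K"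
  shows "(z - y) / (x - y) \<in> K" "y + (x - y) * z \<in> K"
proof -
  have nz: "x - y \<noteq> 0" using assms(3) zero_notin_C by metis
  have eq: "(\<lambda>z. (z - y) / (x - y)) ` K = K"
    using difference_clique_normalize[OF K(1,2) assms(1-3)] unique by blast
  thus "(z - y) / (x - y) \<in> K" using assms(4) by blast
  obtain u where "u \<in> K" "z = (u - y) / (x - y)" using assms(4) eq by blast
  thus "y + (x - y) * z \<in> K" using nz by simp
qed

definition H where "H = K \<inter> C 0"

lemma one_in_H: "1 \<in> H"
  using K(3) C_0_closed(3) by (simp add: H_def)

lemma H_scale:
  assumes "h \<in> H" "z \<in> K"
  shows "h * z \<in> K" "z / h \<in> K"
  using clique_affine[of h 0 z] assms K(3) by (auto simp: H_def)

text \<open>As \<open>- 1\<close> is in \<open>C 0\<close>, the pair 0, \<open>h\<close> can be used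
  in reverse order; composed with scaling by \<open>1 / h\<close> this gives the reflection.\<close>

lemma H_reflect:
  assumes "h \<in> H" "z \<in> K"
  shows "h - z \<in> K"
proof -
  have "- h \<in> C 0" using C_0_closed(1)[OF minus_1_in_C_0, of h] assms(1) by (simp add: H_def)
  moreover have "h \<noteq> 0" using assms(1) zero_notin_C by (auto simp: H_def)
  ultimately show ?thesis
    using clique_affine(2)[of 0 h "z / h"] H_scale(2)[OF assms] assms(1) K(3) by (simp add: H_def)
qed

lemma card_H: "card H * d = s - 1"
proof -
  have "H = {x \<in> K. x - 0 \<in> C 0}" by (auto simp: H_def)
  moreover have "card {x \<in> K. x - 0 \<in> C 0} * d = s - 1"
    by (rule card_class_neighbours[OF I K(2)]) (use K in \<open>auto simp: difference_clique_def\<close>)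
  ultimately show ?thesis by simp
qed

lemma H_mult: "x \<in> H \<Longrightarrow> y \<in> H \<Longrightarrow> x * y \<in> H"
  using H_scale(1) C_0_closed(1) by (simp add: H_def)

text \<open>\<open>H\<close> is closed under multiplication and its size divides
  \<open>s - 1\<close>, so its elements are \<open>(s - 1)\<close>-th roots of unity.\<close>

lemma H_subset_F: "H \<subseteq> F"
proof
  fix h assume h: "h \<in> H"
  hence "h ^ card H = 1"
    using zero_notin_C H_mult by (intro power_card_eq_1) (auto simp: H_def)
  hence "h ^ (s - 1) = 1" unfolding card_H[symmetric] power_mult by simp
  thus "h \<in> F" by (simp add: F_conv)
qed

section \<open>Translations of the unique clique and their multiplier ring\<close>

definition T where "T = {b. \<forall>z\<in>K. z + b \<in> K}"

lemma T_subset_K: "T \<subseteq> K"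
  using K(3) by (force simp: T_def)

lemma T_add: "a \<in> T \<Longrightarrow> b \<in> T \<Longrightarrow> a + b \<in> T"
  by (auto simp: T_def add.assoc[symmetric])

lemma T_uminus:
  assumes "b \<in> T"
  shows "- b \<in> T"
proof -
  have "(\<lambda>z. z + b) ` K = K"
    using assms by (intro endo_inj_surj) (auto simp: T_def inj_on_def)
  hence "z - b \<in> K" if "z \<in> K" for z
    using that by (metis (no_types, lifting) add_diff_cancel image_iff)
  thus ?thesis by (simp add: T_def)
qed

text \<open>The translation is the composite of the reflections \<open>z \<mapsto> 1 - z\<close> and
  \<open>z \<mapsto> h - z\<close>.\<close>

lemma H_minus_1_in_T:
  assumes "h \<in> H"
  shows "h - 1 \<in> T"
proof -
  have "z + (h - 1) \<in> K" if "z \<in> K" for z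
    using H_reflect[OF assms H_reflect[OF one_in_H that]] by (simp add: algebra_simps)
  thus ?thesis by (simp add: T_def)
qed

text \<open>Conjugating the translation by \<open>b\<close> with the scaling by \<open>h\<close>
  gives the translation by \<open>h * b\<close>.\<close>

lemma H_mult_T:
  assumes "h \<in> H" "b \<in> T"
  shows "h * b \<in> T"
proof -
  have "h \<noteq> 0" using assms(1) zero_notin_C by (auto simp: H_def)
  moreover have "h * (z / h + b) \<in> K" if "z \<in> K" for z
    using assms H_scale that by (simp add: T_def)
  ultimately show ?thesis by (simp add: T_def distrib_left)
qed

definition S where "S = {x. \<forall>b\<in>T. x * b \<in> T}"

lemma S_closed:
  "x \<in> S \<Longrightarrow> y \<in> S \<Longrightarrow> x + y \<in> S" "x \<in> S \<Longrightarrow> y \<in> S \<Longrightarrow> x * y \<in> S"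
  "x \<in> S \<Longrightarrow> - x \<in> S" "0 \<in> S" "1 \<in> S"
proof -
  have "0 \<in> T" by (simp add: T_def)
  thus "0 \<in> S" by (simp add: S_def)
qed (auto simp: S_def distrib_right mult.assoc T_add T_uminus)

text \<open>In a finite field the inverse is a power, so the ring \<open>S\<close> is a
  subfield.\<close>

lemma S_inverse:
  assumes "x \<in> S"
  shows "inverse x \<in> S"
proof (cases "x = 0")
  case False
  have "x ^ n \<in> S" for n using assms by (induction n) (auto simp: S_closed)
  moreover have "x * x ^ (CARD('a) - 2) = 1"
  proof -
    have "Suc (CARD('a) - 2) = CARD('a) - 1" using CARD_field_gt_1[where 'a='a] by simp
    thus ?thesis using power_CARD_minus_1[OF False] by (metis power_Suc)
  qed
  ultimately show ?thesis by (metis inverse_unique)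
qed (simp add: S_closed)

text \<open>Otherwise \<open>S \<inter> F\<close> is a proper subfield of \<open>F\<close>, hence has at most \<open>sqrt s\<close> elements, yet contains
\<open>H\<close> and \<open>0\<close>, with \<open>card H = (s - 1)/d\<close> and \<open>2d - 1 \<le> Q \<le> sqrt s\<close>.\<close>

lemma F_subset_S: "F \<subseteq> S"
proof (rule ccontr)
  assume "\<not> F \<subseteq> S"
  then obtain x where x: "x \<in> F" "x \<notin> S" by blast
  let ?G = "S \<inter> F" and ?n = "card H"
  \<comment> \<open>1 and \<open>x\<close> are linearly independent over \<open>S\<close>, so
    \<open>F\<close> contains a plane over \<open>S \<inter> F\<close>.\<close>
  have "inj_on (\<lambda>(a, b). a + b * x) (?G \<times> ?G)"
  proof (rule inj_onI, clarsimp)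
    fix a b a' b'
    assume *: "a \<in> S" "b \<in> S" "a' \<in> S" "b' \<in> S" "a + b * x = a' + b' * x"
    have "b = b'"
    proof (rule ccontr)
      assume "b \<noteq> b'"
      hence "x = (a' + - a) * inverse (b + - b')" using *(5) by (simp add: field_simps)
      moreover have "(a' + - a) * inverse (b + - b') \<in> S"
        using * by (intro S_closed S_inverse)
      ultimately show False using x by simp
    qed
    thus "a = a' \<and> b = b'" using *(5) by simp
  qed
  hence "card (?G \<times> ?G) \<le> card F"
    by (rule card_inj_on_le) (use x in \<open>auto intro: F_closed\<close>)
  hence "card ?G * card ?G \<le> s" by (simp add: card_cartesian_product card_F)
  moreover have "card (insert 0 H) \<le> card ?G"
    using H_subset_F H_mult_T S_closed zero_in_F by (intro card_mono) (auto simp: S_def)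
  moreover have "card (insert 0 H) = Suc ?n"
    using zero_notin_C by (subst card_insert_disjoint) (auto simp: H_def)
  ultimately have "Suc ?n * Suc ?n \<le> s" by (metis le_trans mult_le_mono)
  also have s: "s = ?n * d + 1" using card_H s_ge by simp
  finally have "?n * (?n + 2) \<le> ?n * d" by simp
  moreover have "?n > 0" using card_H s_ge by (cases ?n) auto
  ultimately have nd: "?n + 2 \<le> d" using nat_mult_le_cancel1 by blast
  \<comment> \<open>Here \<open>d + 1 \<le> 2 * d - 1 \<le> Q\<close>, since
    \<open>card H + 2 \<le> d\<close> makes \<open>d\<close> at least 3.\<close>
  have "(d + 1) * (d + 1) \<le> Q * Q" using Q_ge nd by (intro mult_mono) auto
  hence "(d + 1) * (d + 1) \<le> ?n * d + 1" using Q2_le_s s by linarith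
  moreover have "(d + 1) * (d + 1) = d * d + 2 * d + 1" by simp
  moreover have "?n * d \<le> d * d" using nd by (intro mult_le_mono1) simp
  ultimately show False using nd by linarith
qed

text \<open>Some \<open>h \<noteq> 1\<close> in \<open>H\<close> gives the nonzero translation
  \<open>h - 1\<close>. Its inverse lies in \<open>F\<close>, hence in \<open>S\<close>, and scales
  it to 1; multiplying by \<open>F\<close> puts all of \<open>F\<close> into
  \<open>T\<close>.\<close>

lemma F_subset_K: "F \<subseteq> K"
proof -
  have "card H \<noteq> 0" "card H \<noteq> 1"
  proof -
    have "3 * (2 * d - 1) \<le> Q * Q" using Q_ge by (intro mult_mono) auto
    hence "3 * (2 * d - 1) \<le> s" using Q2_le_s by linarith
    thus "card H \<noteq> 0" "card H \<noteq> 1" using card_H s_ge d_pos by auto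
  qed
  hence "\<not> H \<subseteq> {1}" by (auto dest!: subset_singletonD)
  then obtain h where h: "h \<in> H" "h \<noteq> 1" by blast
  have "h \<in> F" using h(1) H_subset_F by blast
  hence "1 / (h - 1) \<in> F" by (intro F_closed(3,5) one_in_F)
  hence "1 / (h - 1) \<in> S" using F_subset_S by blast
  hence "1 / (h - 1) * (h - 1) \<in> T" using H_minus_1_in_T[OF h(1)] unfolding S_def by blast
  hence "1 \<in> T" using h by simp
  hence "x * 1 \<in> T" if "x \<in> F" for x using that F_subset_S unfolding S_def by blast
  thus ?thesis using T_subset_K by auto
qed

text \<open>The elements \<open>g ^ ((s + 1) * i)\<close> lie in \<open>F\<close>, hence in
  \<open>K\<close>, and \<open>s\<close> is 1 modulo \<open>2 * d\<close>, so they realize every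
  even index as a difference from 0.\<close>

lemma unique_clique_imp_even_indices:
  assumes "I \<subseteq> {0..2 * d - 1}"
  shows "I = (\<lambda>i. 2 * i) ` {0..<d}"
proof -
  have "2 * i \<in> I" if "i < d" for i
  proof -
    let ?x = "g ^ ((s + 1) * i)"
    have "?x ^ (s - 1) = (g ^ (CARD('a) - 1)) ^ i"
      unfolding CARD_minus_1[symmetric] by (simp only: power_mult[symmetric] mult_ac)
    also have "\<dots> = 1" by (simp add: power_CARD_minus_1 g_nonzero del: One_nat_def)
    finally have "?x \<in> K" using F_subset_K by (auto simp: F_conv)
    hence "?x - 0 \<in> (\<Union>j\<in>I. C j)"
      using K(1,3) g_nonzero unfolding difference_clique_def by (metis insert_subset power_not_zero)
    then obtain j where j: "j \<in> I" "?x \<in> C j" by auto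
    obtain M where M: "M * (2 * d) = CARD('a) - 1" using class_cofactor .
    have "[(s + 1) * i = j] (mod (2 * d))"
      using j(2) unfolding C_def primitive_root_power_mem_cyclotomic_class_iff[OF prim M] .
    moreover have "[s + 1 = 2] (mod (2 * d))"
      using dvd_s_minus_1 s_ge by (simp add: cong_altdef_nat)
    hence "[(s + 1) * i = 2 * i] (mod (2 * d))" by (rule cong_mult) simp
    ultimately have "[2 * i = j] (mod (2 * d))" by (metis cong_sym cong_trans)
    moreover have "2 * i < 2 * d" "j < 2 * d" using that j(1) assms d_pos by auto
    ultimately have "2 * i = j" by (simp only: cong_less_modulus_unique_nat)
    thus ?thesis using j(1) by simp
  qed
  hence "(\<lambda>i. 2 * i) ` {0..<d} \<subseteq> I" by auto
  moreover have "card ((\<lambda>i. 2 * i) ` {0..<d}) = card I"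
    using I by (subst card_image) (auto simp: inj_on_def)
  moreover have "finite I" using assms by (rule finite_subset) simp
  ultimately show ?thesis using card_seteq by (metis order_refl)
qed

end

text \<open>The neighbour count provides a pair in \<open>K\<close> with difference in
  \<open>C 0\<close>, so \<open>K\<close> can be normalized to contain 0 and 1; were the result
  unique, \<open>I\<close> would be the even indices.\<close>

lemma two_normalized_cliques:
  assumes I: "card I = d" "0 \<in> I" "I \<subseteq> {0..2 * d - 1}" "I \<noteq> (\<lambda>i. 2 * i) ` {0..<d}"
    and K: "difference_clique I K" "card K = s"
  shows "\<exists>K1 K2. K1 \<noteq> K2 \<and> (\<forall>L\<in>{K1, K2}. difference_clique I L \<and> card L = s \<and> {0, 1} \<subseteq> L)"
proof -
  obtain y where y: "y \<in> K" using K(2) s_ge by (metis all_not_in_conv card.empty not_numeral_le_zero)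
  have "card {x \<in> K. x - y \<in> C 0} * d = s - 1"
    by (rule card_class_neighbours[OF I(1,2) K(2) _ y]) (use K in \<open>auto simp: difference_clique_def\<close>)
  hence "card {x \<in> K. x - y \<in> C 0} \<noteq> 0" using s_ge by (intro notI) simp
  hence "{x \<in> K. x - y \<in> C 0} \<noteq> {}" by (metis card.empty)
  then obtain x where "x \<in> K" "x - y \<in> C 0" by blast
  then obtain K1 where K1: "difference_clique I K1" "card K1 = s" "{0, 1} \<subseteq> K1"
    using difference_clique_normalize[OF K _ y] by metis
  have "\<exists>K2. difference_clique I K2 \<and> card K2 = s \<and> {0, 1} \<subseteq> K2 \<and> K2 \<noteq> K1"
  proof (rule ccontr)
    assume "\<not> ?thesis"
    hence "K' = K1" if "difference_clique I K'" "card K' = s" "{0, 1} \<subseteq> K'" for K'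
      using that by metis
    from unique_clique_imp_even_indices[OF I(1,2) K1 this I(3)] show False using I(4) by simp
  qed
  then obtain K2 where "difference_clique I K2" "card K2 = s" "{0, 1} \<subseteq> K2" "K2 \<noteq> K1" by metis
  thus ?thesis using K1 by (intro exI[of _ K1] exI[of _ K2]) simp
qed

end

theorem theorem1p9:
  fixes p d t r :: nat
    and g :: "'a::{field, finite}"
    and I :: "nat set"
  assumes "prime p" and "odd p"
    and "d \<ge> 1"
    and "\<exists>k::nat. [int p ^ k = - 1] (mod int (2 * d))"
    and "t = (LEAST s. 0 < s \<and> [int p ^ s = - 1] (mod int (2 * d)))"
    and "even r" and "r > 0"
    and "CARD('a) = p ^ (2 * r * t)"
    and "primitive_root g"
    and "I \<subseteq> {0..2 * d - 1}" and "card I = d" and "0 \<in> I"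
    and "I \<noteq> (\<lambda>i. 2 * i) ` {0..<d}"
    and "real (clique_number (PP g d I)) = sqrt (real CARD('a))"
  shows "card {K. clique K (PP g d I) \<and> real (card K) = sqrt (real CARD('a)) \<and> {0, 1} \<subseteq> K} \<ge> 2"
proof -
  \<comment> \<open>The given exponent may be 0. Then \<open>2 * d\<close> divides 2, so
    \<open>d = 1\<close>, and exponent 1 works because \<open>p\<close> is odd. Hence the least
    positive exponent exists.\<close>
  have "\<exists>k>0. [int p ^ k = - 1] (mod int (2 * d))"
  proof -
    obtain k where k: "[int p ^ k = - 1] (mod int (2 * d))" using assms(4) by blast
    show ?thesis
    proof (cases "k = 0")
      case True
      hence "int (2 * d) dvd 2" using k by (simp add: cong_iff_dvd_diff)
      hence "int (2 * d) \<le> 2" by (rule zdvd_imp_le) simp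
      hence "d = 1" using assms(3) by simp
      moreover have "even (int p ^ 1 - (- 1))" using assms(2) by simp
      ultimately show ?thesis by (intro exI[of _ 1]) (simp add: cong_iff_dvd_diff)
    qed (use k in blast)
  qed
  hence t: "0 < t" "[int p ^ t = - 1] (mod int (2 * d))"
    unfolding assms(5) by (rule LeastI2_ex, simp)+
  have "int (2 * d) dvd int (p ^ t + 1)"
    using t(2) by (simp add: cong_iff_dvd_diff add.commute)
  hence dvd: "2 * d dvd p ^ t + 1" by (simp only: int_dvd_int_iff)
  obtain \<psi> :: "'a \<Rightarrow> complex" where \<psi>:
    "\<And>x y. \<psi> (x + y) = \<psi> x * \<psi> y" "\<And>x. norm (\<psi> x) = 1"
    "\<And>x. \<psi> (x ^ p) = \<psi> x" "\<exists>x. \<psi> x \<noteq> 1"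
    using additive_character_exists[OF assms(1,8)] by metis
  interpret semiprimitive_field \<psi> p t r d g
    by unfold_locales (use assms \<psi> t dvd in auto)
  have sqrt: "sqrt (real CARD('a)) = real s" by (simp add: CARD_eq)
  have adj: "{x, y} \<in> PP g d I \<longleftrightarrow> x - y \<in> (\<Union>j\<in>I. C j)" for x y :: 'a
  proof -
    \<comment> \<open>Edges are unordered, so each class must be symmetric; this comes from
      \<open>- 1\<close> being in \<open>C 0\<close>.\<close>
    have "x - y \<in> (\<Union>j\<in>I. C j)" if yx: "y - x \<in> (\<Union>j\<in>I. C j)" for x y :: 'a
    proof -
      obtain j where "j \<in> I" "y - x \<in> C j" using yx by blast
      moreover from this have "- 1 * (y - x) \<in> C j" by (intro C_mult minus_1_in_C_0)
      ultimately show ?thesis by auto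
    qed
    thus ?thesis unfolding PP_def cayley_edges_def C_def[symmetric] by (auto simp: doubleton_eq_iff)
  qed
  have clique: "clique K (PP g d I) \<longleftrightarrow> difference_clique I K" for K
    unfolding clique_def difference_clique_def adj ..
  have "clique_number (PP g d I) \<in> card ` {K. clique K (PP g d I)}"
    unfolding clique_number_def
  proof (rule Max_in)
    have "{} \<in> {K. clique K (PP g d I)}" by simp
    thus "card ` {K. clique K (PP g d I)} \<noteq> {}" by blast
  qed simp
  then obtain K where K: "clique K (PP g d I)" "card K = clique_number (PP g d I)" by auto
  have "card K = s" using assms(14) K(2) unfolding sqrt by simp
  with K clique have "difference_clique I K" "card K = s" by auto
  from two_normalized_cliques[OF assms(11,12,10,13) this]
  obtain K1 K2 where K12: "K1 \<noteq> K2"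
    "\<forall>L\<in>{K1, K2}. difference_clique I L \<and> card L = s \<and> {0, 1} \<subseteq> L" by blast
  have "card {K1, K2} \<le> card {K. clique K (PP g d I) \<and> real (card K) = sqrt (real CARD('a)) \<and> {0, 1} \<subseteq> K}"
    using K12(2) unfolding sqrt clique by (intro card_mono) auto
  thus ?thesis using K12(1) by simp
qed
end
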